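(* For all positive integers $n$ and $d$, there exist a subgroup of finite index $\Gamma\subset\mathrm{Out}(F_n)$ and a monomorphism $\Gamma\hookrightarrow\mathrm{Out}(F_m)$, where $m=d(n-1)+1$.
   Context: $F_k$ denotes the free group of rank $k$ and $\mathrm{Out}(F_k)=\mathrm{Aut}(F_k)/\mathrm{Inn}(F_k)$. *)

theory Defs
  imports "HOL-Algebra.Coset" "HOL-Algebra.Bij"
begin

text \<open>
  A letter \<open>(s, True)\<close> stands for the generator \<open>s\<close> and \<open>(s, False)\<close> for its inverse. The elements
  of the free group on \<open>S\<close> are the freely reduced words in these letters.
\<close>

definition inv_letter :: "'a \<times> bool \<Rightarrow> 'a \<times> bool" where
  "inv_letter x = (fst x, \<not> snd x)"

definition reduced :: "('a \<times> bool) list \<Rightarrow> bool" where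
  "reduced w \<longleftrightarrow> successively (\<lambda>x y. y \<noteq> inv_letter x) w"

fun cancel_cons :: "'a \<times> bool \<Rightarrow> ('a \<times> bool) list \<Rightarrow> ('a \<times> bool) list" where
  "cancel_cons x [] = [x]"
| "cancel_cons x (y # w) = (if y = inv_letter x then w else x # y # w)"

text \<open>
  On reduced words \<open>u\<close> and \<open>v\<close> the multiplication below is concatenation followed by free reduction:
  the letters of \<open>u\<close> are put in front of \<open>v\<close> from right to left, cancelling where possible.
\<close>

definition free_group :: "'a set \<Rightarrow> ('a \<times> bool) list monoid" where
  "free_group S =
    \<lparr>carrier = {w. reduced w \<and> fst ` set w \<subseteq> S},
     mult = (\<lambda>u v. foldr cancel_cons u v),
     one = []\<rparr>"

definition free_group_rank :: "nat \<Rightarrow> (nat \<times> bool) list monoid" where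
  "free_group_rank k = free_group {..<k}"

definition inner_aut :: "('a, 'b) monoid_scheme \<Rightarrow> 'a \<Rightarrow> 'a \<Rightarrow> 'a" where
  "inner_aut G g = (\<lambda>x \<in> carrier G. g \<otimes>\<^bsub>G\<^esub> x \<otimes>\<^bsub>G\<^esub> inv\<^bsub>G\<^esub> g)"

definition Inn :: "('a, 'b) monoid_scheme \<Rightarrow> ('a \<Rightarrow> 'a) set" where
  "Inn G = inner_aut G ` carrier G"

definition Out :: "('a, 'b) monoid_scheme \<Rightarrow> ('a \<Rightarrow> 'a) set monoid" where
  "Out G = AutoGroup G Mod Inn G"

definition finite_index_subgroup :: "'a set \<Rightarrow> ('a, 'b) monoid_scheme \<Rightarrow> bool" where
  "finite_index_subgroup H G \<longleftrightarrow> subgroup H G \<and> finite (rcosets\<^bsub>G\<^esub> H)"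


subsection \<open>The free group is a group\<close>

lemma inv_letter_inv_letter [simp]: "inv_letter (inv_letter x) = x"
  by (simp add: inv_letter_def)

lemma fst_inv_letter [simp]: "fst (inv_letter x) = fst x"
  by (simp add: inv_letter_def)

lemma inv_letter_eq_iff: "y = inv_letter x \<longleftrightarrow> x = inv_letter y"
  by auto

lemma reduced_Nil [simp]: "reduced []"
  by (simp add: reduced_def)

lemma reduced_Cons:
  "reduced (x # w) \<longleftrightarrow> reduced w \<and> (w = [] \<or> hd w \<noteq> inv_letter x)"
  by (cases w) (auto simp: reduced_def)

lemma reduced_cancel_cons: "reduced w \<Longrightarrow> reduced (cancel_cons x w)"
  by (cases w) (auto simp: reduced_Cons)

lemma set_cancel_cons: "set (cancel_cons x w) \<subseteq> insert x (set w)"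
  by (cases w) auto

lemma cancel_cons_inv_letter:
  "reduced w \<Longrightarrow> cancel_cons (inv_letter x) (cancel_cons x w) = w"
proof (cases w)
  case (Cons y v)
  assume "reduced w"
  then show ?thesis using Cons by (cases v) (auto simp: reduced_Cons)
qed simp

lemma cancel_cons_inv_letter':
  "reduced w \<Longrightarrow> cancel_cons x (cancel_cons (inv_letter x) w) = w"
  using cancel_cons_inv_letter[of w "inv_letter x"] by simp

lemma reduced_foldr: "reduced v \<Longrightarrow> reduced (foldr cancel_cons u v)"
  by (induction u) (auto simp: reduced_cancel_cons)

lemma set_foldr_cancel_cons: "set (foldr cancel_cons u v) \<subseteq> set u \<union> set v"
proof (induction u)
  case (Cons x u)
  then show ?case using set_cancel_cons[of x "foldr cancel_cons u v"] by auto
qed simp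

lemma foldr_cancel_cons_Nil: "reduced u \<Longrightarrow> foldr cancel_cons u [] = u"
proof (induction u)
  case (Cons x u)
  then show ?case by (cases u) (auto simp: reduced_Cons)
qed simp

lemma foldr_cancel_cons_cancel_cons:
  "reduced w \<Longrightarrow>
    foldr cancel_cons (cancel_cons x u) w = cancel_cons x (foldr cancel_cons u w)"
  by (cases u) (auto simp: cancel_cons_inv_letter' reduced_foldr)

lemma foldr_cancel_cons_assoc:
  "reduced w \<Longrightarrow>
    foldr cancel_cons (foldr cancel_cons u v) w = foldr cancel_cons u (foldr cancel_cons v w)"
  by (induction u) (auto simp: foldr_cancel_cons_cancel_cons)

lemma foldr_cancel_cons_inverse:
  "reduced w \<Longrightarrow> foldr cancel_cons (rev (map inv_letter u)) (foldr cancel_cons u w) = w"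
  by (induction u arbitrary: w) (auto simp: cancel_cons_inv_letter reduced_foldr)

lemma group_free_group: "group (free_group S)"
proof (rule groupI)
  fix u assume u: "u \<in> carrier (free_group S)"
  define v where "v = foldr cancel_cons (rev (map inv_letter u)) []"
  have "reduced v" by (simp add: v_def reduced_foldr)
  moreover have "set v \<subseteq> inv_letter ` set u"
    using set_foldr_cancel_cons[of "rev (map inv_letter u)" "[]"] by (simp add: v_def)
  ultimately have "v \<in> carrier (free_group S)"
    using u by (fastforce simp: free_group_def)
  moreover have "foldr cancel_cons v u = []"
    using u foldr_cancel_cons_assoc[of u "rev (map inv_letter u)" "[]"]
      foldr_cancel_cons_inverse[of "[]" u]
    by (simp add: v_def free_group_def foldr_cancel_cons_Nil)
  ultimately show "\<exists>v\<in>carrier (free_group S). v \<otimes>\<^bsub>free_group S\<^esub> u = \<one>\<^bsub>free_group S\<^esub>"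
    by (auto simp: free_group_def)
next
  fix u v assume "u \<in> carrier (free_group S)" "v \<in> carrier (free_group S)"
  then show "u \<otimes>\<^bsub>free_group S\<^esub> v \<in> carrier (free_group S)"
    using set_foldr_cancel_cons[of u v] by (fastforce simp: free_group_def reduced_foldr)
qed (auto simp: free_group_def foldr_cancel_cons_assoc)


subsection \<open>The universal property\<close>

definition letter_val :: "('b, 'c) monoid_scheme \<Rightarrow> ('a \<Rightarrow> 'b) \<Rightarrow> 'a \<times> bool \<Rightarrow> 'b" where
  "letter_val G f x = (if snd x then f (fst x) else inv\<^bsub>G\<^esub> f (fst x))"

definition word_val :: "('b, 'c) monoid_scheme \<Rightarrow> ('a \<Rightarrow> 'b) \<Rightarrow> ('a \<times> bool) list \<Rightarrow> 'b" where
  "word_val G f w = foldr (\<lambda>x g. letter_val G f x \<otimes>\<^bsub>G\<^esub> g) w \<one>\<^bsub>G\<^esub>"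

context group
begin

lemma letter_val_closed: "f \<in> S \<rightarrow> carrier G \<Longrightarrow> fst x \<in> S \<Longrightarrow> letter_val G f x \<in> carrier G"
  by (auto simp: letter_val_def)

lemma letter_val_inv_letter:
  "f \<in> S \<rightarrow> carrier G \<Longrightarrow> fst x \<in> S \<Longrightarrow> letter_val G f (inv_letter x) = inv (letter_val G f x)"
  by (auto simp: letter_val_def inv_letter_def Pi_iff)

lemma word_val_closed: "f \<in> S \<rightarrow> carrier G \<Longrightarrow> fst ` set w \<subseteq> S \<Longrightarrow> word_val G f w \<in> carrier G"
  by (induction w) (auto simp: word_val_def letter_val_closed)

lemma word_val_cancel_cons:
  assumes "f \<in> S \<rightarrow> carrier G" "fst x \<in> S" "fst ` set w \<subseteq> S"
  shows "word_val G f (cancel_cons x w) = letter_val G f x \<otimes> word_val G f w"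
proof (cases w)
  case (Cons y v)
  then have v: "word_val G f v \<in> carrier G" and x: "letter_val G f x \<in> carrier G"
    using assms word_val_closed[of f S v] letter_val_closed[of f S x] by auto
  show ?thesis
    using v x assms
    by (auto simp: Cons word_val_def letter_val_inv_letter m_assoc[symmetric])
qed (simp add: word_val_def)

lemma word_val_foldr:
  assumes "f \<in> S \<rightarrow> carrier G" "fst ` set u \<subseteq> S" "fst ` set v \<subseteq> S"
  shows "word_val G f (foldr cancel_cons u v) = word_val G f u \<otimes> word_val G f v"
  using assms(2)
proof (induction u)
  case Nil
  then show ?case using assms word_val_closed[of f S v] by (simp add: word_val_def)
next
  case (Cons x u)
  have "fst ` set (foldr cancel_cons u v) \<subseteq> S"
    using Cons.prems assms(3) set_foldr_cancel_cons[of u v] by fastforce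
  then show ?case
    using Cons assms word_val_closed[of f S] letter_val_closed[of f S x]
    by (simp add: word_val_cancel_cons m_assoc) (simp add: word_val_def m_assoc)
qed

lemma word_val_hom: "f \<in> S \<rightarrow> carrier G \<Longrightarrow> word_val G f \<in> hom (free_group S) G"
  by (auto simp: hom_def free_group_def word_val_closed word_val_foldr)

end

lemma inv_free_group_letter:
  assumes "fst x \<in> S"
  shows "inv\<^bsub>free_group S\<^esub> [x] = [inv_letter x]"
  using assms
  by (intro group.inv_equality[OF group_free_group]) (auto simp: free_group_def reduced_Cons)

theorem free_group_universal:
  assumes "group G" and f: "f \<in> S \<rightarrow> carrier G"
  shows "\<exists>!h. h \<in> hom (free_group S) G \<and> h \<in> extensional (carrier (free_group S)) \<and>
    (\<forall>s\<in>S. h [(s, True)] = f s)"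
proof (rule ex1I)
  interpret group G by fact
  interpret F: group "free_group S" by (rule group_free_group)
  define e where "e = restrict (word_val G f) (carrier (free_group S))"
  have "e \<in> hom (free_group S) G"
    using word_val_hom[OF f] F.m_closed by (auto simp: e_def hom_def)
  moreover have "e [(s, True)] = f s" if "s \<in> S" for s
    using that f by (auto simp: e_def free_group_def word_val_def letter_val_def reduced_Cons Pi_iff)
  ultimately show "e \<in> hom (free_group S) G \<and> e \<in> extensional (carrier (free_group S)) \<and>
    (\<forall>s\<in>S. e [(s, True)] = f s)"
    by (simp add: e_def)
  fix h assume h: "h \<in> hom (free_group S) G \<and> h \<in> extensional (carrier (free_group S)) \<and>
    (\<forall>s\<in>S. h [(s, True)] = f s)"
  interpret h: group_hom "free_group S" G h
    using h by (intro group_hom.intro group_hom_axioms.intro F.is_group is_group) blast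
  have letter: "h [x] = letter_val G f x" if "fst x \<in> S" for x
  proof (cases "snd x")
    case True
    then have "x = (fst x, True)" by (simp add: prod_eq_iff)
    moreover have "h [(fst x, True)] = f (fst x)" using h that by blast
    ultimately show ?thesis using True by (metis letter_val_def)
  next
    case False
    let ?y = "(fst x, True)"
    have "[?y] \<in> carrier (free_group S)" using that by (simp add: free_group_def reduced_Cons)
    then have "h (inv\<^bsub>free_group S\<^esub> [?y]) = inv\<^bsub>G\<^esub> (h [?y])" by (rule h.hom_inv)
    moreover have "inv_letter ?y = x" using False by (simp add: inv_letter_def prod_eq_iff)
    moreover have "h [?y] = f (fst x)" using h that by blast
    ultimately show ?thesis
      using False that by (simp add: inv_free_group_letter letter_val_def)
  qed
  have word: "h w = word_val G f w" if "w \<in> carrier (free_group S)" for w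
    using that
  proof (induction w)
    case Nil
    then show ?case using h.hom_one by (simp add: free_group_def word_val_def)
  next
    case (Cons x w)
    then have xw: "[x] \<in> carrier (free_group S)" "w \<in> carrier (free_group S)" "fst x \<in> S"
      by (auto simp: free_group_def reduced_Cons)
    have "x # w = [x] \<otimes>\<^bsub>free_group S\<^esub> w"
      using Cons.prems by (cases w) (auto simp: free_group_def reduced_Cons)
    then have "h (x # w) = h [x] \<otimes>\<^bsub>G\<^esub> h w" using xw h.hom_mult by metis
    then show ?case using Cons.IH xw letter by (simp add: word_val_def)
  qed
  show "h = e"
  proof (rule extensionalityI[of _ "carrier (free_group S)"])
    show "h \<in> extensional (carrier (free_group S))" using h by blast
  qed (auto simp: e_def word)
qed


subsection \<open>Inner automorphisms and \<open>Out\<close>\<close>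

context group
begin

lemma inv_cancel_left: "g \<in> carrier G \<Longrightarrow> x \<in> carrier G \<Longrightarrow> inv g \<otimes> (g \<otimes> x) = x"
  by (simp add: m_assoc[symmetric])

lemma inv_cancel_right: "g \<in> carrier G \<Longrightarrow> x \<in> carrier G \<Longrightarrow> g \<otimes> (inv g \<otimes> x) = x"
  by (simp add: m_assoc[symmetric])

lemma inner_aut_closed: "g \<in> carrier G \<Longrightarrow> x \<in> carrier G \<Longrightarrow> inner_aut G g x \<in> carrier G"
  by (simp add: inner_aut_def)

lemma inner_aut_auto:
  assumes g: "g \<in> carrier G"
  shows "inner_aut G g \<in> auto G"
proof -
  have "bij_betw (inner_aut G g) (carrier G) (carrier G)"
    by (rule bij_betw_byWitness[where f' = "inner_aut G (inv g)"])
      (use g in \<open>auto simp: inner_aut_def m_assoc inv_cancel_left inv_cancel_right\<close>)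
  moreover have "inner_aut G g \<in> hom G G"
    using g by (auto simp: inner_aut_def hom_def m_assoc inv_cancel_left)
  ultimately show ?thesis
    by (simp add: auto_def Bij_def inner_aut_def)
qed

lemma carrier_AutoGroup: "carrier (AutoGroup G) = auto G"
  by (simp add: AutoGroup_def)

lemma mult_AutoGroup:
  "f \<in> auto G \<Longrightarrow> h \<in> auto G \<Longrightarrow> f \<otimes>\<^bsub>AutoGroup G\<^esub> h = compose (carrier G) f h"
  by (simp add: AutoGroup_def BijGroup_def auto_def)

lemma inner_aut_mult:
  assumes "g \<in> carrier G" "h \<in> carrier G"
  shows "inner_aut G (g \<otimes> h) = inner_aut G g \<otimes>\<^bsub>AutoGroup G\<^esub> inner_aut G h"
proof -
  have "inner_aut G (g \<otimes> h) = compose (carrier G) (inner_aut G g) (inner_aut G h)"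
    using assms by (auto simp: compose_def inner_aut_def inv_mult_group m_assoc)
  then show ?thesis using assms by (simp add: mult_AutoGroup inner_aut_auto)
qed

lemma inner_aut_group_hom: "group_hom G (AutoGroup G) (inner_aut G)"
  by (intro group_hom.intro group_hom_axioms.intro AutoGroup is_group)
    (auto simp: hom_def carrier_AutoGroup inner_aut_auto inner_aut_mult)

lemma auto_conjugate:
  assumes f: "f \<in> auto G" and g: "g \<in> carrier G"
  shows "f \<otimes>\<^bsub>AutoGroup G\<^esub> inner_aut G g = inner_aut G (f g) \<otimes>\<^bsub>AutoGroup G\<^esub> f"
proof -
  interpret f: group_hom G G f
    using f by unfold_locales (simp add: auto_def)
  have "compose (carrier G) f (inner_aut G g) = compose (carrier G) (inner_aut G (f g)) f"
    using g by (auto simp: compose_def inner_aut_def)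
  then show ?thesis using f g by (simp add: mult_AutoGroup inner_aut_auto)
qed

lemma Inn_normal: "Inn G \<lhd> AutoGroup G"
proof -
  interpret A: group "AutoGroup G" by (rule AutoGroup)
  interpret i: group_hom G "AutoGroup G" "inner_aut G" by (rule inner_aut_group_hom)
  have "subgroup (Inn G) (AutoGroup G)"
    unfolding Inn_def by (rule i.img_is_subgroup)
  moreover have "f \<otimes>\<^bsub>AutoGroup G\<^esub> h \<otimes>\<^bsub>AutoGroup G\<^esub> inv\<^bsub>AutoGroup G\<^esub> f \<in> Inn G"
    if f: "f \<in> carrier (AutoGroup G)" and h: "h \<in> Inn G" for f h
  proof -
    obtain g where g: "g \<in> carrier G" "h = inner_aut G g"
      using h by (auto simp: Inn_def)
    have fa: "f \<in> auto G" using f by (simp add: carrier_AutoGroup)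
    then have fg: "f g \<in> carrier G" using g by (auto simp: auto_def hom_def)
    have "f \<otimes>\<^bsub>AutoGroup G\<^esub> h \<otimes>\<^bsub>AutoGroup G\<^esub> inv\<^bsub>AutoGroup G\<^esub> f = inner_aut G (f g)"
      using auto_conjugate[OF fa g(1)] f fg i.hom_closed[OF fg]
      by (simp add: g(2) A.m_assoc)
    then show ?thesis using fg by (simp add: Inn_def)
  qed
  ultimately show ?thesis
    by (simp add: A.normal_inv_iff)
qed

theorem group_Out: "group (Out G)"
  unfolding Out_def by (rule normal.factorgroup_is_group[OF Inn_normal])

end

end

theory Submission
  imports Defs "HOL-Algebra.Elementary_Groups" "HOL-Algebra.Group_Action"
begin

text \<open>
  For \<open>n = 1\<close> the two ranks agree and the identity works. For \<open>n > 1\<close> write \<open>F\<close> for the free group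
  of rank \<open>n\<close>, \<open>E\<close> for the free group of rank \<open>m\<close>, \<open>t\<close> and \<open>b\<close> for the first two generators of
  \<open>F\<close>, and let \<open>K\<close> be the kernel of the map from \<open>F\<close> to the integers modulo \<open>d\<close> that sends \<open>t\<close> to \<open>1\<close>
  and the other generators to \<open>0\<close>. Geometrically \<open>K\<close> belongs to a cyclic \<open>d\<close>-sheeted cover of a
  rose, and it is free of rank \<open>m\<close>: there is an injective homomorphism \<open>\<psi>\<close> from \<open>E\<close> to \<open>F\<close> with image
  \<open>K\<close> (\<open>\<psi>_mon\<close>, \<open>\<psi>_image\<close>).

  An automorphism of \<open>F\<close> that preserves \<open>K\<close> restricts to an automorphism of \<open>K\<close>, and the
  restriction determines it, even up to conjugation by elements of \<open>K\<close>, because \<open>K\<close> is normal with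
  trivial centralizer. The obstacle is that conjugation by an element of \<open>F\<close> outside \<open>K\<close> is trivial
  in \<open>Out F\<close> but may be nontrivial in \<open>Out K\<close>. So one needs a subgroup of finite
  index in \<open>Aut F\<close> that preserves \<open>K\<close> and whose inner members are all conjugations by elements of \<open>K\<close>;
  its image in \<open>Out F\<close> then embeds in \<open>Out K\<close> (\<open>restricted_outer_mon\<close>).

  Such a subgroup is the stabilizer of a homomorphism \<open>h\<close> from \<open>F\<close> to a finite group, under
  precomposition. Its index is finite because \<open>F\<close> is finitely generated, and conjugation by \<open>g\<close> lies in
  it only if \<open>h g\<close> commutes with the image of \<open>h\<close>. Take for \<open>h\<close> the action on
  \<open>{0, 1} \<times> {0, \<dots>, d - 1}\<close> in which \<open>t\<close> moves the \<open>d\<close> fibres cyclically, \<open>b\<close> exchanges the two points of the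
  fibre over \<open>0\<close>, and the other generators act trivially. A permutation \<open>h g\<close> that commutes with \<open>h b\<close> preserves the only
  fibre moved by \<open>h b\<close>, so \<open>g\<close> has degree \<open>0\<close> and lies in \<open>K\<close>. The same action determines
  the degree, so its stabilizer preserves \<open>K\<close>.
\<close>

section \<open>Subgroups of finite index and monomorphisms out of them\<close>

text \<open>
  Two homomorphisms on \<open>S\<close> with the same kernel have isomorphic images. Here one of them is the
  restriction of \<open>p\<close>, and the isomorphism is read as a monomorphism defined on \<open>p ` S\<close>.
\<close>

lemma mon_on_image:
  assumes p: "group_hom A B p" and S: "subgroup S A" and C: "group C"
    and R: "R \<in> hom (A \<lparr>carrier := S\<rparr>) C"
    and ker: "\<And>x. x \<in> S \<Longrightarrow> R x = \<one>\<^bsub>C\<^esub> \<longleftrightarrow> p x = \<one>\<^bsub>B\<^esub>"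
  shows "\<exists>\<phi>. \<phi> \<in> mon (B \<lparr>carrier := p ` S\<rparr>) C"
proof -
  interpret p: group_hom A B p by (rule p)
  interpret C: group C by (rule C)
  interpret S: group "A \<lparr>carrier := S\<rparr>" using S by (rule subgroup.subgroup_is_group) (rule p.G.is_group)
  interpret R: group_hom "A \<lparr>carrier := S\<rparr>" C R
    by (intro group_hom.intro group_hom_axioms.intro S.is_group C R)
  have SA: "x \<in> carrier A" if "x \<in> S" for x
    using that subgroup.subset[OF S] by blast
  have Rp: "R x = R y \<longleftrightarrow> p x = p y" if x: "x \<in> S" and y: "y \<in> S" for x y
  proof -
    have inv: "inv\<^bsub>A \<lparr>carrier := S\<rparr>\<^esub> y = inv\<^bsub>A\<^esub> y"
      using p.G.m_inv_consistent[OF S y] by simp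
    have iS: "inv\<^bsub>A\<^esub> y \<in> S" using S y by (simp add: subgroup.m_inv_closed)
    have xy: "x \<otimes>\<^bsub>A\<^esub> inv\<^bsub>A\<^esub> y \<in> S" using S x iS by (simp add: subgroup.m_closed)
    have "R (x \<otimes>\<^bsub>A\<^esub> inv\<^bsub>A\<^esub> y) = R x \<otimes>\<^bsub>C\<^esub> inv\<^bsub>C\<^esub> R y"
      using R.hom_mult[of x "inv\<^bsub>A\<^esub> y"] R.hom_inv[of y] x y iS by (simp add: inv)
    moreover have "p (x \<otimes>\<^bsub>A\<^esub> inv\<^bsub>A\<^esub> y) = p x \<otimes>\<^bsub>B\<^esub> inv\<^bsub>B\<^esub> p y"
      using SA x y by simp
    moreover have "R x \<in> carrier C" "R y \<in> carrier C" using R.hom_closed x y by simp_all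
    ultimately show ?thesis
      using ker[OF xy] C.inv_solve_right[of "\<one>\<^bsub>C\<^esub>" "R x" "R y"]
        p.H.inv_solve_right[of "\<one>\<^bsub>B\<^esub>" "p x" "p y"] SA x y by (auto simp: eq_commute)
  qed
  define \<phi> where "\<phi> y = R (inv_into S p y)" for y
  have \<phi>: "\<phi> (p x) = R x" if "x \<in> S" for x
    using Rp[OF inv_into_into[of "p x" p S] that] that by (simp add: \<phi>_def f_inv_into_f)
  have "\<phi> \<in> hom (B \<lparr>carrier := p ` S\<rparr>) C"
  proof (rule homI)
    fix x assume "x \<in> carrier (B \<lparr>carrier := p ` S\<rparr>)"
    then show "\<phi> x \<in> carrier C" using R.hom_closed by (auto simp: \<phi>)
  next
    fix x y assume "x \<in> carrier (B \<lparr>carrier := p ` S\<rparr>)" "y \<in> carrier (B \<lparr>carrier := p ` S\<rparr>)"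
    then obtain a b where ab: "a \<in> S" "b \<in> S" "x = p a" "y = p b" by auto
    then have "\<phi> (p (a \<otimes>\<^bsub>A\<^esub> b)) = R a \<otimes>\<^bsub>C\<^esub> R b"
      using R.hom_mult[of a b] S by (simp add: \<phi> subgroup.m_closed)
    then show "\<phi> (x \<otimes>\<^bsub>B \<lparr>carrier := p ` S\<rparr>\<^esub> y) = \<phi> x \<otimes>\<^bsub>C\<^esub> \<phi> y"
      using ab SA by (simp add: \<phi>)
  qed
  moreover have "inj_on \<phi> (p ` S)"
    using Rp by (auto simp: inj_on_def \<phi>)
  ultimately show ?thesis by (auto simp: mon_def)
qed

text \<open>
  The function \<open>f\<close> separates right cosets of \<open>H\<close>, so there are at most as many cosets as values.
\<close>

lemma (in group) finite_index_subgroupI: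
  assumes H: "subgroup H G" and fin: "finite (f ` carrier G)"
    and f: "\<And>x y. x \<in> carrier G \<Longrightarrow> y \<in> carrier G \<Longrightarrow> f x = f y \<Longrightarrow> x \<otimes> inv y \<in> H"
  shows "finite_index_subgroup H G"
proof -
  define r where "r v = (SOME x. x \<in> carrier G \<and> f x = v)" for v
  have "H #> x = H #> r (f x)" if x: "x \<in> carrier G" for x
  proof -
    have r: "r (f x) \<in> carrier G \<and> f (r (f x)) = f x"
      unfolding r_def by (rule someI) (use x in blast)
    then have "x \<otimes> inv r (f x) \<in> H" using f x by metis
    then have "x \<in> H #> r (f x)"
      using r x by (auto simp: r_coset_def m_assoc intro!: bexI[of _ "x \<otimes> inv r (f x)"])
    then show ?thesis using repr_independence r H by metis
  qed
  then have "rcosets H \<subseteq> (\<lambda>v. H #> r v) ` f ` carrier G"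
    by (auto simp: RCOSETS_def)
  then show ?thesis
    using fin H finite_surj by (auto simp: finite_index_subgroup_def)
qed

lemma (in group) finite_index_subgroup_carrier: "finite_index_subgroup (carrier G) G"
  by (rule finite_index_subgroupI[where f = "\<lambda>_. ()"]) (auto simp: subgroup_self)

lemma (in group_hom) finite_index_subgroup_image:
  assumes "h ` carrier G = carrier H" "finite_index_subgroup S G"
  shows "finite_index_subgroup (h ` S) H"
proof -
  have S: "subgroup S G" "finite (rcosets S)"
    using assms(2) by (auto simp: finite_index_subgroup_def)
  have "h ` S #>\<^bsub>H\<^esub> h x = h ` (S #> x)" if "x \<in> carrier G" for x
    using that subgroup.mem_carrier[OF S(1)] by (force simp: r_coset_def)
  then have "rcosets\<^bsub>H\<^esub> (h ` S) \<subseteq> (\<lambda>X. h ` X) ` (rcosets S)"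
    unfolding RCOSETS_def assms(1)[symmetric] by auto
  then show ?thesis
    using S finite_surj by (auto simp: finite_index_subgroup_def subgroup_img_is_subgroup)
qed

section \<open>Restricting automorphisms to a normal subgroup with trivial centralizer\<close>

lemma auto_hom: "\<phi> \<in> auto G \<Longrightarrow> x \<in> carrier G \<Longrightarrow> y \<in> carrier G \<Longrightarrow> \<phi> (x \<otimes>\<^bsub>G\<^esub> y) = \<phi> x \<otimes>\<^bsub>G\<^esub> \<phi> y"
  by (simp add: auto_def hom_def)

lemma auto_closed: "\<phi> \<in> auto G \<Longrightarrow> x \<in> carrier G \<Longrightarrow> \<phi> x \<in> carrier G"
  by (auto simp: auto_def hom_def)

lemma autoI:
  assumes "f \<in> hom G G" "bij_betw f (carrier G) (carrier G)" "f \<in> extensional (carrier G)"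
  shows "f \<in> auto G"
  using assms by (simp add: auto_def Bij_def)

lemma (in group) AutoGroup_inv_apply:
  assumes "\<phi> \<in> auto G" "x \<in> carrier G"
  shows "(inv\<^bsub>AutoGroup G\<^esub> \<phi>) (\<phi> x) = x" "\<phi> ((inv\<^bsub>AutoGroup G\<^esub> \<phi>) x) = x"
    "inv\<^bsub>AutoGroup G\<^esub> \<phi> \<in> auto G"
proof -
  interpret A: group "AutoGroup G" by (rule AutoGroup)
  have \<phi>: "\<phi> \<in> carrier (AutoGroup G)" using assms by (simp add: carrier_AutoGroup)
  show i: "inv\<^bsub>AutoGroup G\<^esub> \<phi> \<in> auto G" using A.inv_closed[OF \<phi>] by (simp add: carrier_AutoGroup)
  have one: "\<one>\<^bsub>AutoGroup G\<^esub> = (\<lambda>x\<in>carrier G. x)" by (simp add: AutoGroup_def BijGroup_def)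
  show "(inv\<^bsub>AutoGroup G\<^esub> \<phi>) (\<phi> x) = x"
    using A.l_inv[OF \<phi>] assms i one
    by (simp add: mult_AutoGroup compose_def fun_eq_iff) (metis restrict_apply')
  show "\<phi> ((inv\<^bsub>AutoGroup G\<^esub> \<phi>) x) = x"
    using A.r_inv[OF \<phi>] assms i one
    by (simp add: mult_AutoGroup compose_def fun_eq_iff) (metis restrict_apply')
qed

lemma (in group) Out_proj:
  "group_hom (AutoGroup G) (Out G) (\<lambda>\<phi>. Inn G #>\<^bsub>AutoGroup G\<^esub> \<phi>)"
  "(\<lambda>\<phi>. Inn G #>\<^bsub>AutoGroup G\<^esub> \<phi>) ` carrier (AutoGroup G) = carrier (Out G)"
  using normal.r_coset_hom_Mod[OF Inn_normal] AutoGroup group_Out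
  by (auto simp: group_hom_def group_hom_axioms_def Out_def FactGroup_def RCOSETS_def)

lemma (in group) Out_proj_eq_one:
  assumes "\<phi> \<in> auto G"
  shows "Inn G #>\<^bsub>AutoGroup G\<^esub> \<phi> = \<one>\<^bsub>Out G\<^esub> \<longleftrightarrow> \<phi> \<in> Inn G"
proof -
  interpret A: group "AutoGroup G" by (rule AutoGroup)
  have I: "subgroup (Inn G) (AutoGroup G)" using Inn_normal by (simp add: normal_imp_subgroup)
  show ?thesis
    using A.coset_join1[OF _ _ I] A.coset_join2[OF _ I] subgroup.subset[OF I] assms
    by (auto simp: Out_def FactGroup_def carrier_AutoGroup)
qed

text \<open>
  The map on outer automorphisms is induced by \<open>\<phi> \<mapsto> \<psi>\<^sup>-\<^sup>1 \<circ> \<phi> \<circ> \<psi>\<close>. It is well defined and injective because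
  this restriction is inner in \<open>H\<close> exactly when \<open>\<phi>\<close> is inner in \<open>G\<close>. From right to left this is the
  assumption on inner members of \<open>S\<close>. Conversely, let \<open>\<phi>\<close> agree on the image \<open>K\<close> of \<open>\<psi>\<close> with
  conjugation by \<open>c \<in> K\<close>. For \<open>x \<in> G\<close> and \<open>k \<in> K\<close> compare the two expressions for
  \<open>\<phi> (x k x\<^sup>-\<^sup>1)\<close>: they show that \<open>x\<^sup>-\<^sup>1 c\<^sup>-\<^sup>1 \<phi>(x) c\<close> commutes with \<open>k\<close>. So this element is trivial
  and \<open>\<phi>\<close> is conjugation by \<open>c\<close> on all of \<open>G\<close>.
\<close>

lemma restricted_outer_mon:
  fixes G :: "('a, 'c) monoid_scheme" and H :: "('b, 'e) monoid_scheme"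
  assumes G: "group G" and H: "group H" and \<psi>: "\<psi> \<in> mon H G"
    and normal: "\<psi> ` carrier H \<lhd> G"
    and centralizer: "\<And>x. x \<in> carrier G \<Longrightarrow>
      (\<forall>u\<in>carrier H. x \<otimes>\<^bsub>G\<^esub> \<psi> u = \<psi> u \<otimes>\<^bsub>G\<^esub> x) \<Longrightarrow> x = \<one>\<^bsub>G\<^esub>"
    and S: "subgroup S (AutoGroup G)"
    and stable: "\<And>\<phi> x. \<phi> \<in> S \<Longrightarrow> x \<in> \<psi> ` carrier H \<Longrightarrow> \<phi> x \<in> \<psi> ` carrier H"
    and inner: "\<And>g. g \<in> carrier G \<Longrightarrow> inner_aut G g \<in> S \<Longrightarrow> g \<in> \<psi> ` carrier H"
  shows "\<exists>\<Phi>. \<Phi> \<in> mon (Out G \<lparr>carrier := (\<lambda>\<phi>. Inn G #>\<^bsub>AutoGroup G\<^esub> \<phi>) ` S\<rparr>) (Out H)"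
proof -
  interpret G: group G by (rule G)
  interpret H: group H by (rule H)
  interpret A: group "AutoGroup G" by (rule G.AutoGroup)
  interpret B: group "AutoGroup H" by (rule H.AutoGroup)
  interpret \<psi>: group_hom H G \<psi>
    using \<psi> by unfold_locales (simp add: mon_def)
  interpret q: group_hom "AutoGroup H" "Out H" "\<lambda>\<phi>. Inn H #>\<^bsub>AutoGroup H\<^esub> \<phi>"
    by (rule H.Out_proj)
  define K where "K = \<psi> ` carrier H"
  have inj: "\<psi> u = \<psi> v \<longleftrightarrow> u = v" if "u \<in> carrier H" "v \<in> carrier H" for u v
    using \<psi> that by (auto simp: mon_def inj_on_def)
  have SA: "\<phi> \<in> auto G" if "\<phi> \<in> S" for \<phi>
    using that subgroup.subset[OF S] by (auto simp: G.carrier_AutoGroup)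
  have K: "\<psi> u \<in> K" "\<psi> u \<in> carrier G" if "u \<in> carrier H" for u
    using that by (auto simp: K_def)
  define R where "R \<phi> = (\<lambda>u\<in>carrier H. inv_into (carrier H) \<psi> (\<phi> (\<psi> u)))" for \<phi>
  have R: "R \<phi> u \<in> carrier H" "\<psi> (R \<phi> u) = \<phi> (\<psi> u)" if "\<phi> \<in> S" "u \<in> carrier H" for \<phi> u
    using stable[OF that(1), of "\<psi> u"] that by (auto simp: R_def inv_into_into f_inv_into_f)
  have R_auto: "R \<phi> \<in> auto H" if \<phi>: "\<phi> \<in> S" for \<phi>
  proof (rule autoI)
    show "R \<phi> \<in> hom H H"
    proof (rule homI)
      fix u v assume uv: "u \<in> carrier H" "v \<in> carrier H"
      have "\<psi> (R \<phi> (u \<otimes>\<^bsub>H\<^esub> v)) = \<psi> (R \<phi> u \<otimes>\<^bsub>H\<^esub> R \<phi> v)"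
        using uv R \<phi> K by (simp add: auto_hom[OF SA[OF \<phi>]])
      then show "R \<phi> (u \<otimes>\<^bsub>H\<^esub> v) = R \<phi> u \<otimes>\<^bsub>H\<^esub> R \<phi> v"
        using uv inj R(1)[OF \<phi>] by (simp del: \<psi>.hom_mult)
    qed (use R \<phi> in blast)
    have i: "inv\<^bsub>AutoGroup G\<^esub> \<phi> \<in> S" using S \<phi> by (rule subgroup.m_inv_closed)
    show "bij_betw (R \<phi>) (carrier H) (carrier H)"
    proof (rule bij_betw_byWitness[where f' = "R (inv\<^bsub>AutoGroup G\<^esub> \<phi>)"])
      show "\<forall>u\<in>carrier H. R (inv\<^bsub>AutoGroup G\<^esub> \<phi>) (R \<phi> u) = u"
        using R[OF i] R[OF \<phi>] inj K G.AutoGroup_inv_apply[OF SA[OF \<phi>]] by metis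
      show "\<forall>u\<in>carrier H. R \<phi> (R (inv\<^bsub>AutoGroup G\<^esub> \<phi>) u) = u"
        using R[OF i] R[OF \<phi>] inj K G.AutoGroup_inv_apply[OF SA[OF \<phi>]] by metis
    qed (use R i \<phi> in auto)
    show "R \<phi> \<in> extensional (carrier H)" by (simp add: R_def)
  qed
  have R_hom: "R \<in> hom (AutoGroup G \<lparr>carrier := S\<rparr>) (AutoGroup H)"
  proof (rule homI)
    fix \<phi> \<chi> assume "\<phi> \<in> carrier (AutoGroup G \<lparr>carrier := S\<rparr>)" "\<chi> \<in> carrier (AutoGroup G \<lparr>carrier := S\<rparr>)"
    then have in_S: "\<phi> \<in> S" "\<chi> \<in> S" by auto
    have comp: "\<phi> \<otimes>\<^bsub>AutoGroup G\<^esub> \<chi> \<in> S" using S in_S by (simp add: subgroup.m_closed)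
    have "R (\<phi> \<otimes>\<^bsub>AutoGroup G\<^esub> \<chi>) u = R \<phi> (R \<chi> u)" if u: "u \<in> carrier H" for u
    proof -
      have "\<psi> (R (\<phi> \<otimes>\<^bsub>AutoGroup G\<^esub> \<chi>) u) = \<psi> (R \<phi> (R \<chi> u))"
        using R comp in_S u K SA by (simp add: G.mult_AutoGroup compose_eq)
      then show ?thesis using R(1) comp in_S u inj by metis
    qed
    then have "R (\<phi> \<otimes>\<^bsub>AutoGroup G\<^esub> \<chi>) = compose (carrier H) (R \<phi>) (R \<chi>)"
      by (auto simp: compose_def fun_eq_iff R_def)
    then show "R (\<phi> \<otimes>\<^bsub>AutoGroup G \<lparr>carrier := S\<rparr>\<^esub> \<chi>) = R \<phi> \<otimes>\<^bsub>AutoGroup H\<^esub> R \<chi>"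
      using in_S R_auto by (simp add: H.mult_AutoGroup)
  qed (use R_auto in \<open>auto simp: H.carrier_AutoGroup\<close>)
  have R_inner: "R \<phi> \<in> Inn H \<longleftrightarrow> \<phi> \<in> Inn G" if \<phi>: "\<phi> \<in> S" for \<phi>
  proof
    assume "\<phi> \<in> Inn G"
    then obtain g where g: "g \<in> carrier G" "\<phi> = inner_aut G g" by (auto simp: Inn_def)
    then obtain v where v: "v \<in> carrier H" "g = \<psi> v" using inner \<phi> by auto
    have "R \<phi> u = inner_aut H v u" if u: "u \<in> carrier H" for u
    proof -
      have "\<psi> (R \<phi> u) = \<psi> (inner_aut H v u)"
        using R \<phi> u v g by (simp add: inner_aut_def)
      then show ?thesis using inj R(1)[OF \<phi> u] H.inner_aut_closed[OF v(1) u] by metis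
    qed
    then have "R \<phi> = inner_aut H v" by (auto simp: fun_eq_iff R_def inner_aut_def)
    then show "R \<phi> \<in> Inn H" using v by (simp add: Inn_def)
  next
    assume "R \<phi> \<in> Inn H"
    then obtain v where v: "v \<in> carrier H" "R \<phi> = inner_aut H v" by (auto simp: Inn_def)
    define c where "c = \<psi> v"
    have c: "c \<in> carrier G" using v by (simp add: c_def)
    have on_K: "\<phi> k = c \<otimes>\<^bsub>G\<^esub> k \<otimes>\<^bsub>G\<^esub> inv\<^bsub>G\<^esub> c" if k: "k \<in> K" for k
    proof -
      obtain u where u: "u \<in> carrier H" "k = \<psi> u" using k by (auto simp: K_def)
      then show ?thesis using R(2)[OF \<phi> u(1)] v by (simp add: inner_aut_def c_def)
    qed
    have "\<phi> x = c \<otimes>\<^bsub>G\<^esub> x \<otimes>\<^bsub>G\<^esub> inv\<^bsub>G\<^esub> c" if x: "x \<in> carrier G" for x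
    proof -
      define y where "y = inv\<^bsub>G\<^esub> x \<otimes>\<^bsub>G\<^esub> (inv\<^bsub>G\<^esub> c \<otimes>\<^bsub>G\<^esub> \<phi> x \<otimes>\<^bsub>G\<^esub> c)"
      have \<phi>x: "\<phi> x \<in> carrier G" using SA \<phi> x by (simp add: auto_closed)
      have y: "y \<in> carrier G" using x c \<phi>x by (simp add: y_def)
      have "y \<otimes>\<^bsub>G\<^esub> \<psi> u = \<psi> u \<otimes>\<^bsub>G\<^esub> y" if u: "u \<in> carrier H" for u
      proof -
        define k where "k = \<psi> u"
        have k: "k \<in> K" "k \<in> carrier G" using K u by (auto simp: k_def)
        define k' where "k' = x \<otimes>\<^bsub>G\<^esub> k \<otimes>\<^bsub>G\<^esub> inv\<^bsub>G\<^esub> x"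
        have k': "k' \<in> K" "k' \<in> carrier G"
          using normal.inv_op_closed2[OF normal x, of k] k x by (auto simp: k'_def K_def)
        have "k' \<otimes>\<^bsub>G\<^esub> x = x \<otimes>\<^bsub>G\<^esub> k" using k x by (simp add: k'_def G.m_assoc)
        then have "\<phi> k' \<otimes>\<^bsub>G\<^esub> \<phi> x = \<phi> x \<otimes>\<^bsub>G\<^esub> \<phi> k"
          using auto_hom[OF SA[OF \<phi>]] k k' x by metis
        then have e: "c \<otimes>\<^bsub>G\<^esub> k' \<otimes>\<^bsub>G\<^esub> inv\<^bsub>G\<^esub> c \<otimes>\<^bsub>G\<^esub> \<phi> x = \<phi> x \<otimes>\<^bsub>G\<^esub> (c \<otimes>\<^bsub>G\<^esub> k \<otimes>\<^bsub>G\<^esub> inv\<^bsub>G\<^esub> c)"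
          using on_K k k' by simp
        have "k \<otimes>\<^bsub>G\<^esub> y = inv\<^bsub>G\<^esub> x \<otimes>\<^bsub>G\<^esub> inv\<^bsub>G\<^esub> c \<otimes>\<^bsub>G\<^esub> (c \<otimes>\<^bsub>G\<^esub> k' \<otimes>\<^bsub>G\<^esub> inv\<^bsub>G\<^esub> c \<otimes>\<^bsub>G\<^esub> \<phi> x) \<otimes>\<^bsub>G\<^esub> c"
          using k x c \<phi>x by (simp add: y_def k'_def G.m_assoc G.inv_cancel_left)
        also have "\<dots> = y \<otimes>\<^bsub>G\<^esub> k"
          using k x c \<phi>x by (simp add: e y_def G.m_assoc)
        finally show ?thesis by (simp add: k_def)
      qed
      then have "y = \<one>\<^bsub>G\<^esub>" using centralizer y by blast
      then have "x = inv\<^bsub>G\<^esub> c \<otimes>\<^bsub>G\<^esub> \<phi> x \<otimes>\<^bsub>G\<^esub> c"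
        using x c \<phi>x G.inv_equality[of "inv\<^bsub>G\<^esub> x" "inv\<^bsub>G\<^esub> c \<otimes>\<^bsub>G\<^esub> \<phi> x \<otimes>\<^bsub>G\<^esub> c"]
        by (simp add: y_def) (metis G.inv_equality G.inv_inv G.m_closed G.inv_closed)
      then have "c \<otimes>\<^bsub>G\<^esub> x \<otimes>\<^bsub>G\<^esub> inv\<^bsub>G\<^esub> c = c \<otimes>\<^bsub>G\<^esub> (inv\<^bsub>G\<^esub> c \<otimes>\<^bsub>G\<^esub> \<phi> x \<otimes>\<^bsub>G\<^esub> c) \<otimes>\<^bsub>G\<^esub> inv\<^bsub>G\<^esub> c"
        by simp
      then show ?thesis
        using c \<phi>x by (simp add: G.m_assoc G.inv_cancel_right)
    qed
    then have "\<phi> = inner_aut G c"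
      using SA[OF \<phi>] by (auto simp: inner_aut_def auto_def Bij_def extensional_def fun_eq_iff)
    then show "\<phi> \<in> Inn G" using c by (simp add: Inn_def)
  qed
  show ?thesis
  proof (rule mon_on_image[OF G.Out_proj(1) S H.group_Out])
    show "(\<lambda>\<phi>. Inn H #>\<^bsub>AutoGroup H\<^esub> R \<phi>) \<in> hom (AutoGroup G \<lparr>carrier := S\<rparr>) (Out H)"
      using hom_compose[OF R_hom q.homh] by (simp add: comp_def)
    show "(Inn H #>\<^bsub>AutoGroup H\<^esub> R \<phi> = \<one>\<^bsub>Out H\<^esub>) = (Inn G #>\<^bsub>AutoGroup G\<^esub> \<phi> = \<one>\<^bsub>Out G\<^esub>)"
      if "\<phi> \<in> S" for \<phi>
      using that R_inner R_auto SA by (simp add: H.Out_proj_eq_one G.Out_proj_eq_one)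
  qed
qed

section \<open>Words, generators and centralizers in a free group\<close>

lemma generator_closed: "s \<in> S \<Longrightarrow> [(s, b)] \<in> carrier (free_group S)"
  by (simp add: free_group_def reduced_Cons)

lemma free_group_generated:
  assumes B: "subgroup B (free_group S)" and gens: "\<And>s. s \<in> S \<Longrightarrow> [(s, True)] \<in> B"
  shows "carrier (free_group S) \<subseteq> B"
proof
  interpret F: group "free_group S" by (rule group_free_group)
  fix w assume "w \<in> carrier (free_group S)"
  then show "w \<in> B"
  proof (induction w)
    case Nil
    then show ?case using subgroup.one_closed[OF B] by (simp add: free_group_def)
  next
    case (Cons x w)
    then have xw: "w \<in> carrier (free_group S)" "fst x \<in> S"
      by (auto simp: free_group_def reduced_Cons)
    have "[x] \<in> B"
    proof (cases "snd x")
      case True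
      then show ?thesis using gens[OF xw(2)] by (metis prod.collapse)
    next
      case False
      then have "[x] = inv\<^bsub>free_group S\<^esub> [(fst x, True)]"
        using xw by (simp add: inv_free_group_letter inv_letter_def prod_eq_iff)
      then show ?thesis using gens[OF xw(2)] B by (simp add: subgroup.m_inv_closed)
    qed
    moreover have "x # w = [x] \<otimes>\<^bsub>free_group S\<^esub> w"
      using Cons.prems by (cases w) (auto simp: free_group_def reduced_Cons)
    ultimately show ?case using Cons.IH xw B by (simp add: subgroup.m_closed)
  qed
qed

lemma free_group_hom_eqI:
  assumes "group G" and f: "f \<in> hom (free_group S) G" and g: "g \<in> hom (free_group S) G"
    and gens: "\<And>s. s \<in> S \<Longrightarrow> f [(s, True)] = g [(s, True)]"
    and w: "w \<in> carrier (free_group S)"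
  shows "f w = g w"
proof -
  interpret F: group "free_group S" by (rule group_free_group)
  interpret f: group_hom "free_group S" G f
    using assms by (intro group_hom.intro group_hom_axioms.intro F.is_group)
  interpret g: group_hom "free_group S" G g
    using assms by (intro group_hom.intro group_hom_axioms.intro F.is_group)
  have "subgroup {w \<in> carrier (free_group S). f w = g w} (free_group S)"
    by (rule F.subgroupI) (use F.one_closed f.hom_one g.hom_one in auto)
  from free_group_generated[OF this] gens w show ?thesis by (auto simp: generator_closed)
qed

lemma (in group) word_val_generator:
  "f \<in> S \<rightarrow> carrier G \<Longrightarrow> s \<in> S \<Longrightarrow> word_val G f [(s, True)] = f s"
  by (auto simp: word_val_def letter_val_def Pi_iff)

text \<open>
  The multiplication of reduced words recurses on its left factor; this lemma gives access to the
  right end of a word.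
\<close>

lemma foldr_cancel_cons_single:
  assumes "reduced w"
  shows "foldr cancel_cons w [x] = (if w \<noteq> [] \<and> last w = inv_letter x then butlast w else w @ [x])"
  using assms
proof (induction w)
  case (Cons y w)
  then have "reduced w" by (simp add: reduced_Cons)
  note IH = Cons.IH[OF this]
  show ?case
  proof (cases w)
    case Nil
    then show ?thesis by (auto simp: inv_letter_eq_iff)
  next
    case (Cons z v)
    then have "z \<noteq> inv_letter y" using Cons.prems \<open>reduced (y # w)\<close> by (simp add: reduced_Cons)
    then show ?thesis using IH Cons by (cases v) auto
  qed
qed simp

text \<open>
  If \<open>w\<close> did not begin with \<open>s\<close> or its inverse, then \<open>s w\<close> would be a reduced word longer than \<open>w\<close>. Being
  equal to \<open>w s\<close>, it would be \<open>w\<close> followed by \<open>s\<close>, so \<open>w\<close> would begin with \<open>s\<close> after all.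
\<close>

lemma first_letter_of_centralizer_of_generator:
  assumes w: "w \<in> carrier (free_group S)" "w \<noteq> []"
    and comm: "w \<otimes>\<^bsub>free_group S\<^esub> [(s, True)] = [(s, True)] \<otimes>\<^bsub>free_group S\<^esub> w"
  shows "fst (hd w) = s"
proof (rule ccontr)
  assume ne: "fst (hd w) \<noteq> s"
  obtain y v where yv: "w = y # v" using w by (cases w) auto
  have red: "reduced w" using w by (simp add: free_group_def)
  have "foldr cancel_cons w [(s, True)] = cancel_cons (s, True) w"
    using comm by (simp add: free_group_def)
  also have "\<dots> = (s, True) # w"
    using ne by (auto simp: yv inv_letter_def)
  finally have eq: "foldr cancel_cons w [(s, True)] = (s, True) # w" .
  \<comment> \<open>The product is longer than \<open>w\<close>, so no letter cancels when \<open>s\<close> is appended to \<open>w\<close>.\<close>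
  moreover have "butlast w \<noteq> (s, True) # w"
    by (auto dest: arg_cong[of _ _ length])
  ultimately have "w @ [(s, True)] = (s, True) # w"
    unfolding foldr_cancel_cons_single[OF red] by (simp split: if_splits)
  then show False using ne yv by auto
qed

text \<open>
  If a nontrivial \<open>w\<close> commutes with \<open>s\<close> and with \<open>t s t\<^sup>-\<^sup>1\<close>, then \<open>w\<close> and \<open>v = t\<^sup>-\<^sup>1 w t\<close> both commute with
  \<open>s\<close>. So \<open>w\<close> begins with \<open>s\<close> or its inverse; then nothing cancels in \<open>t\<^sup>-\<^sup>1 w\<close>, and \<open>v\<close> begins with
  \<open>t\<^sup>-\<^sup>1\<close>, which contradicts the same fact for \<open>v\<close>.
\<close>

lemma trivial_centralizer_of_generator_and_conjugate:
  assumes st: "s \<in> S" "t \<in> S" "s \<noteq> t" and w: "w \<in> carrier (free_group S)"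
    and s: "w \<otimes>\<^bsub>free_group S\<^esub> [(s, True)] = [(s, True)] \<otimes>\<^bsub>free_group S\<^esub> w"
    and ts: "w \<otimes>\<^bsub>free_group S\<^esub> ([(t, True)] \<otimes>\<^bsub>free_group S\<^esub> [(s, True)] \<otimes>\<^bsub>free_group S\<^esub> inv\<^bsub>free_group S\<^esub> [(t, True)]) =
      [(t, True)] \<otimes>\<^bsub>free_group S\<^esub> [(s, True)] \<otimes>\<^bsub>free_group S\<^esub> inv\<^bsub>free_group S\<^esub> [(t, True)] \<otimes>\<^bsub>free_group S\<^esub> w"
  shows "w = \<one>\<^bsub>free_group S\<^esub>"
proof (rule ccontr)
  interpret F: group "free_group S" by (rule group_free_group)
  assume "w \<noteq> \<one>\<^bsub>free_group S\<^esub>"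
  then have ne: "w \<noteq> []" by (simp add: free_group_def)
  have hd: "fst (hd w) = s" by (rule first_letter_of_centralizer_of_generator[OF w ne s])
  let ?x = "[(s, True)]" and ?t = "[(t, True)]"
  note tx = generator_closed[OF st(1), of True] generator_closed[OF st(2), of True]
  define v where "v = inv\<^bsub>free_group S\<^esub> ?t \<otimes>\<^bsub>free_group S\<^esub> w \<otimes>\<^bsub>free_group S\<^esub> ?t"
  have v: "v \<in> carrier (free_group S)" using w tx by (simp add: v_def)
  have "v \<otimes>\<^bsub>free_group S\<^esub> ?x = inv\<^bsub>free_group S\<^esub> ?t \<otimes>\<^bsub>free_group S\<^esub> (w \<otimes>\<^bsub>free_group S\<^esub> (?t \<otimes>\<^bsub>free_group S\<^esub> ?x \<otimes>\<^bsub>free_group S\<^esub> inv\<^bsub>free_group S\<^esub> ?t)) \<otimes>\<^bsub>free_group S\<^esub> ?t"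
    using w tx by (simp add: v_def F.m_assoc)
  also have "\<dots> = ?x \<otimes>\<^bsub>free_group S\<^esub> v"
    unfolding ts using w tx by (simp add: v_def F.m_assoc F.inv_cancel_left)
  finally have comm: "v \<otimes>\<^bsub>free_group S\<^esub> ?x = ?x \<otimes>\<^bsub>free_group S\<^esub> v" .
  have tw: "inv\<^bsub>free_group S\<^esub> ?t \<otimes>\<^bsub>free_group S\<^esub> w = (t, False) # w"
    using ne hd st inv_free_group_letter[of "(t, True)" S]
    by (cases w) (auto simp: inv_letter_def free_group_def)
  have "(t, False) # w \<in> carrier (free_group S)"
    unfolding tw[symmetric] using w tx by simp
  then have red: "reduced ((t, False) # w)" by (simp add: free_group_def)
  have "v = foldr cancel_cons ((t, False) # w) ?t"
    unfolding v_def tw by (simp add: free_group_def)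
  \<comment> \<open>Multiplying by \<open>t\<close> on the right cannot delete the first letter, as \<open>w\<close> is not empty.\<close>
  then have "fst (hd v) = t \<and> v \<noteq> []"
    unfolding foldr_cancel_cons_single[OF red] using ne by simp
  then show False
    using first_letter_of_centralizer_of_generator[OF v _ comm] st by auto
qed

section \<open>Stabilizers of homomorphisms to finite groups\<close>

definition hom_stabilizer :: "('a, 'c) monoid_scheme \<Rightarrow> ('a \<Rightarrow> 'b) \<Rightarrow> ('a \<Rightarrow> 'a) set" where
  "hom_stabilizer G h = {\<phi> \<in> auto G. \<forall>x\<in>carrier G. h (\<phi> x) = h x}"

lemma (in group) hom_stabilizer_subgroup: "subgroup (hom_stabilizer G h) (AutoGroup G)"
proof -
  interpret A: group "AutoGroup G" by (rule AutoGroup)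
  show ?thesis
  proof (rule A.subgroupI)
    show "hom_stabilizer G h \<subseteq> carrier (AutoGroup G)"
      by (auto simp: hom_stabilizer_def carrier_AutoGroup)
    show "hom_stabilizer G h \<noteq> {}"
      using id_in_auto by (auto simp: hom_stabilizer_def intro!: exI[of _ "\<lambda>x\<in>carrier G. x"])
  next
    fix \<phi> assume \<phi>: "\<phi> \<in> hom_stabilizer G h"
    then have a: "\<phi> \<in> auto G" by (simp add: hom_stabilizer_def)
    have "h ((inv\<^bsub>AutoGroup G\<^esub> \<phi>) x) = h x" if x: "x \<in> carrier G" for x
      using \<phi> x AutoGroup_inv_apply[OF a x] auto_closed[of "inv\<^bsub>AutoGroup G\<^esub> \<phi>" G x]
      by (metis (mono_tags, lifting) hom_stabilizer_def mem_Collect_eq)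
    then show "inv\<^bsub>AutoGroup G\<^esub> \<phi> \<in> hom_stabilizer G h"
      using AutoGroup_inv_apply(3)[OF a one_closed] by (simp add: hom_stabilizer_def)
  next
    fix \<phi> \<chi> assume \<phi>: "\<phi> \<in> hom_stabilizer G h" and \<chi>: "\<chi> \<in> hom_stabilizer G h"
    then have "\<phi> \<otimes>\<^bsub>AutoGroup G\<^esub> \<chi> \<in> auto G"
      using A.m_closed[of \<phi> \<chi>] by (simp add: hom_stabilizer_def carrier_AutoGroup)
    then show "\<phi> \<otimes>\<^bsub>AutoGroup G\<^esub> \<chi> \<in> hom_stabilizer G h"
      using \<phi> \<chi> by (auto simp: hom_stabilizer_def mult_AutoGroup compose_eq auto_closed)
  qed
qed

text \<open>
  An orbit-stabilizer argument: the coset of \<open>\<phi>\<close> is determined by \<open>h \<circ> \<phi>\<close>, which is determined by its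
  values in \<open>Q\<close> on the finitely many generators.
\<close>

lemma finite_index_hom_stabilizer:
  assumes S: "finite S" and Q: "group Q" "finite (carrier Q)" and h: "h \<in> hom (free_group S) Q"
  shows "finite_index_subgroup (hom_stabilizer (free_group S) h) (AutoGroup (free_group S))"
proof -
  let ?F = "free_group S"
  interpret F: group ?F by (rule group_free_group)
  interpret A: group "AutoGroup ?F" by (rule F.AutoGroup)
  define f where "f \<phi> = (\<lambda>s\<in>S. h (\<phi> [(s, True)]))" for \<phi>
  have "f \<phi> \<in> S \<rightarrow>\<^sub>E carrier Q" if "\<phi> \<in> auto ?F" for \<phi>
    using that h by (auto simp: f_def generator_closed auto_closed hom_in_carrier)
  then have "f ` carrier (AutoGroup ?F) \<subseteq> S \<rightarrow>\<^sub>E carrier Q"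
    unfolding F.carrier_AutoGroup by blast
  then have fin: "finite (f ` carrier (AutoGroup ?F))"
    by (rule finite_subset) (intro finite_PiE S Q)
  show ?thesis
  proof (rule A.finite_index_subgroupI[OF F.hom_stabilizer_subgroup fin])
    fix \<phi> \<chi> assume "\<phi> \<in> carrier (AutoGroup ?F)" "\<chi> \<in> carrier (AutoGroup ?F)" and eq: "f \<phi> = f \<chi>"
    then have a: "\<phi> \<in> auto ?F" "\<chi> \<in> auto ?F" by (simp_all add: F.carrier_AutoGroup)
    let ?i = "inv\<^bsub>AutoGroup ?F\<^esub> \<chi>"
    have i: "?i \<in> auto ?F" by (rule F.AutoGroup_inv_apply[OF a(2) F.one_closed])
    have "(h \<circ> \<phi>) w = (h \<circ> \<chi>) w" if w: "w \<in> carrier ?F" for w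
    proof (rule free_group_hom_eqI[OF Q(1) _ _ _ w])
      show "h \<circ> \<phi> \<in> hom ?F Q" "h \<circ> \<chi> \<in> hom ?F Q"
        using a h by (auto simp: auto_def intro: hom_compose)
      show "(h \<circ> \<phi>) [(s, True)] = (h \<circ> \<chi>) [(s, True)]" if "s \<in> S" for s
        using that fun_cong[OF eq, of s] by (simp add: f_def)
    qed
    then have "h (\<phi> (?i w)) = h w" if "w \<in> carrier ?F" for w
      using that F.AutoGroup_inv_apply[OF a(2) that] auto_closed[OF i that] by simp
    moreover have "\<phi> \<otimes>\<^bsub>AutoGroup ?F\<^esub> ?i \<in> auto ?F"
      using A.m_closed[of \<phi> ?i] a i by (simp add: F.carrier_AutoGroup)
    ultimately show "\<phi> \<otimes>\<^bsub>AutoGroup ?F\<^esub> ?i \<in> hom_stabilizer ?F h"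
      using a i by (simp add: hom_stabilizer_def F.mult_AutoGroup compose_eq)
  qed
qed

lemma inner_aut_in_hom_stabilizer:
  assumes "group_hom G Q h" "g \<in> carrier G" "inner_aut G g \<in> hom_stabilizer G h" "x \<in> carrier G"
  shows "h g \<otimes>\<^bsub>Q\<^esub> h x = h x \<otimes>\<^bsub>Q\<^esub> h g"
proof -
  interpret group_hom G Q h by fact
  have "h (g \<otimes>\<^bsub>G\<^esub> x \<otimes>\<^bsub>G\<^esub> inv\<^bsub>G\<^esub> g) = h x"
    using assms by (simp add: hom_stabilizer_def inner_aut_def)
  then have "h g \<otimes>\<^bsub>Q\<^esub> h x \<otimes>\<^bsub>Q\<^esub> inv\<^bsub>Q\<^esub> h g = h x" using assms by simp
  then show ?thesis using assms H.inv_solve_right[of "h x" "h g \<otimes>\<^bsub>Q\<^esub> h x" "h g"] by simp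
qed

section \<open>Free subgroups and permutations from a skew product\<close>

lemma (in group_action) one_apply: "x \<in> E \<Longrightarrow> \<phi> \<one> x = x"
  using id_eq_one by (metis restrict_apply')

lemma (in group_action) inv_apply:
  assumes "g \<in> carrier G" "x \<in> E"
  shows "\<phi> g (\<phi> (inv g) x) = x"
proof -
  interpret group G using group_hom by (simp add: group_hom_def)
  show ?thesis using orbit_sym_aux[OF inv_closed[OF assms(1)] assms(2) refl] assms by simp
qed

lemma left_regular_action:
  assumes "group_hom G Z e"
  shows "group_action G (carrier Z) (\<lambda>g. \<lambda>z\<in>carrier Z. e g \<otimes>\<^bsub>Z\<^esub> z)"
proof -
  interpret group_hom G Z e by fact
  have bij: "(\<lambda>z\<in>carrier Z. e g \<otimes>\<^bsub>Z\<^esub> z) \<in> Bij (carrier Z)" if "g \<in> carrier G" for g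
    using that
    by (auto simp: Bij_def H.inv_cancel_left H.inv_cancel_right
        intro!: bij_betw_byWitness[where f' = "\<lambda>z. inv\<^bsub>Z\<^esub> e g \<otimes>\<^bsub>Z\<^esub> z"])
  have "(\<lambda>g. \<lambda>z\<in>carrier Z. e g \<otimes>\<^bsub>Z\<^esub> z) \<in> hom G (BijGroup (carrier Z))"
    by (rule homI) (auto simp: bij BijGroup_def compose_def H.m_assoc)
  then show ?thesis
    by (intro group_action.intro group_hom.intro group_hom_axioms.intro G.is_group group_BijGroup)
qed

text \<open>
  This turns the evaluation of an action on a whole word into a check on generators: comparing with a
  left regular action determines the first or second component of a skew product, and no case for inverse
  letters arises.
\<close>

lemma equivariant_if_on_generators:
  assumes \<alpha>: "group_action (free_group S) X \<alpha>" and \<beta>: "group_action (free_group S) Y \<beta>"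
    and f: "f \<in> X \<rightarrow> Y"
    and gens: "\<And>s x. s \<in> S \<Longrightarrow> x \<in> X \<Longrightarrow> f (\<alpha> [(s, True)] x) = \<beta> [(s, True)] (f x)"
    and w: "w \<in> carrier (free_group S)" and x: "x \<in> X"
  shows "f (\<alpha> w x) = \<beta> w (f x)"
proof -
  interpret F: group "free_group S" by (rule group_free_group)
  interpret \<alpha>: group_action "free_group S" X \<alpha> by (rule \<alpha>)
  interpret \<beta>: group_action "free_group S" Y \<beta> by (rule \<beta>)
  let ?B = "{w \<in> carrier (free_group S). \<forall>x\<in>X. f (\<alpha> w x) = \<beta> w (f x)}"
  have fY: "f x \<in> Y" if "x \<in> X" for x using f that by blast
  have "subgroup ?B (free_group S)"
  proof (rule F.subgroupI)
    show "?B \<noteq> {}" using \<alpha>.one_apply \<beta>.one_apply fY by force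
  next
    fix w assume w: "w \<in> ?B"
    let ?i = "inv\<^bsub>free_group S\<^esub> w"
    have "f (\<alpha> ?i x) = \<beta> ?i (f x)" if x: "x \<in> X" for x
    proof -
      have y: "\<alpha> ?i x \<in> X" using w x \<alpha>.element_image by blast
      have "\<beta> w (f (\<alpha> ?i x)) = f x" using w x y \<alpha>.inv_apply by fastforce
      then show ?thesis using \<beta>.orbit_sym_aux[of w "f (\<alpha> ?i x)"] w y fY by auto
    qed
    then show "?i \<in> ?B" using w by simp
  next
    fix v w assume v: "v \<in> ?B" and w: "w \<in> ?B"
    have "f (\<alpha> (v \<otimes>\<^bsub>free_group S\<^esub> w) x) = \<beta> (v \<otimes>\<^bsub>free_group S\<^esub> w) (f x)" if x: "x \<in> X" for x
      using v w x \<alpha>.element_image[of w x] fY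
      by (simp add: \<alpha>.composition_rule \<beta>.composition_rule)
    then show "v \<otimes>\<^bsub>free_group S\<^esub> w \<in> ?B" using v w by simp
  qed auto
  from free_group_generated[OF this] gens w x show ?thesis by (auto simp: generator_closed)
qed

text \<open>
  A skew product over the translation of \<open>Z\<close> by \<open>e s\<close>: the generator \<open>s\<close> moves the fibre over \<open>z\<close> to
  the fibre over \<open>e s z\<close> and multiplies it by the label \<open>c s z \<in> H\<close> on the left. The pairs \<open>(s, z)\<close> are the
  edges of a Schreier graph with vertex set \<open>Z\<close>, and \<open>c\<close> labels these edges by elements of \<open>H\<close>.
\<close>

definition skew :: "('b, 'c) monoid_scheme \<Rightarrow> ('z, 'd) monoid_scheme \<Rightarrow> ('a \<Rightarrow> 'z) \<Rightarrow> ('a \<Rightarrow> 'z \<Rightarrow> 'b)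
    \<Rightarrow> 'a \<Rightarrow> 'b \<times> 'z \<Rightarrow> 'b \<times> 'z" where
  "skew H Z e c s = (\<lambda>x\<in>carrier H \<times> carrier Z. (c s (snd x) \<otimes>\<^bsub>H\<^esub> fst x, e s \<otimes>\<^bsub>Z\<^esub> snd x))"

definition skew_action :: "('b, 'c) monoid_scheme \<Rightarrow> ('z, 'd) monoid_scheme \<Rightarrow> ('a \<Rightarrow> 'z) \<Rightarrow> ('a \<Rightarrow> 'z \<Rightarrow> 'b)
    \<Rightarrow> ('a \<times> bool) list \<Rightarrow> 'b \<times> 'z \<Rightarrow> 'b \<times> 'z" where
  "skew_action H Z e c = word_val (BijGroup (carrier H \<times> carrier Z)) (skew H Z e c)"

lemma skew_action_props:
  assumes "group H" "group Z" and e: "e \<in> S \<rightarrow> carrier Z"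
    and c: "c \<in> S \<rightarrow> carrier Z \<rightarrow> carrier H"
  shows skew_action_is_action: "group_action (free_group S) (carrier H \<times> carrier Z) (skew_action H Z e c)"
    and skew_action_generator: "\<And>s u z. s \<in> S \<Longrightarrow> u \<in> carrier H \<Longrightarrow> z \<in> carrier Z \<Longrightarrow>
      skew_action H Z e c [(s, True)] (u, z) = (c s z \<otimes>\<^bsub>H\<^esub> u, e s \<otimes>\<^bsub>Z\<^esub> z)"
    and snd_skew_action: "\<And>w u z. w \<in> carrier (free_group S) \<Longrightarrow> u \<in> carrier H \<Longrightarrow> z \<in> carrier Z \<Longrightarrow>
      snd (skew_action H Z e c w (u, z)) = word_val Z e w \<otimes>\<^bsub>Z\<^esub> z"
proof -
  interpret H: group H by fact
  interpret Z: group Z by fact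
  let ?X = "carrier H \<times> carrier Z"
  interpret B: group "BijGroup ?X" by (rule group_BijGroup)
  have ec: "e s \<in> carrier Z" "c s z \<in> carrier H" if "s \<in> S" "z \<in> carrier Z" for s z
    using that e c by auto
  have "skew H Z e c s \<in> Bij ?X" if s: "s \<in> S" for s
  proof -
    have "bij_betw (skew H Z e c s) ?X ?X"
      by (rule bij_betw_byWitness[where f' = "\<lambda>(u, z). (inv\<^bsub>H\<^esub> c s (inv\<^bsub>Z\<^esub> e s \<otimes>\<^bsub>Z\<^esub> z) \<otimes>\<^bsub>H\<^esub> u, inv\<^bsub>Z\<^esub> e s \<otimes>\<^bsub>Z\<^esub> z)"])
        (use ec[OF s] Z.one_closed in \<open>auto simp: skew_def H.inv_cancel_left H.inv_cancel_right
          Z.inv_cancel_left Z.inv_cancel_right\<close>)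
    then show ?thesis by (simp add: Bij_def skew_def)
  qed
  then have gens: "skew H Z e c \<in> S \<rightarrow> carrier (BijGroup ?X)"
    by (simp add: BijGroup_def)
  then have "skew_action H Z e c \<in> hom (free_group S) (BijGroup ?X)"
    unfolding skew_action_def by (rule B.word_val_hom)
  then show act: "group_action (free_group S) ?X (skew_action H Z e c)"
    by (intro group_action.intro group_hom.intro group_hom_axioms.intro group_free_group B.is_group)
  show gen: "skew_action H Z e c [(s, True)] (u, z) = (c s z \<otimes>\<^bsub>H\<^esub> u, e s \<otimes>\<^bsub>Z\<^esub> z)"
    if "s \<in> S" "u \<in> carrier H" "z \<in> carrier Z" for s u z
    using that B.word_val_generator[OF gens] by (simp add: skew_action_def skew_def)
  interpret e: group_hom "free_group S" Z "word_val Z e"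
    by (intro group_hom.intro group_hom_axioms.intro group_free_group Z.is_group Z.word_val_hom e)
  fix w u z assume w: "w \<in> carrier (free_group S)" and x: "u \<in> carrier H" "z \<in> carrier Z"
  have "snd (skew_action H Z e c w (u, z)) = (\<lambda>g. \<lambda>z\<in>carrier Z. word_val Z e g \<otimes>\<^bsub>Z\<^esub> z) w (snd (u, z))"
  proof (rule equivariant_if_on_generators[OF act left_regular_action[OF e.group_hom_axioms] _ _ w])
    show "snd (skew_action H Z e c [(s, True)] x) = (\<lambda>z\<in>carrier Z. word_val Z e [(s, True)] \<otimes>\<^bsub>Z\<^esub> z) (snd x)"
      if "s \<in> S" "x \<in> ?X" for s x
      using that gen Z.word_val_generator[OF e] by auto
  qed (use x in auto)
  then show "snd (skew_action H Z e c w (u, z)) = word_val Z e w \<otimes>\<^bsub>Z\<^esub> z"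
    using x by simp
qed

section \<open>The subgroup of words whose exponent sum is divisible by d\<close>

text \<open>
  The steps from \<open>z\<close> to \<open>z + 1\<close> in the assumption are the edges of a path through all vertices, hence of a
  maximal tree of the Schreier graph. They carry trivial labels, so moving along them leaves \<open>u\<close> unchanged.
\<close>

lemma nat_pow_generator_skew_action:
  assumes act: "group_action G (carrier H \<times> carrier (integer_mod_group d)) \<alpha>" and x: "x \<in> carrier G"
    and step: "\<And>u z. u \<in> carrier H \<Longrightarrow> 0 \<le> z \<Longrightarrow> z + 1 < int d \<Longrightarrow> \<alpha> x (u, z) = (u, z + 1)"
    and u: "u \<in> carrier H" and j: "j < d"
  shows "\<alpha> (x [^]\<^bsub>G\<^esub> j) (u, 0) = (u, int j)"
  using j
proof (induction j)
  interpret \<alpha>: group_action G "carrier H \<times> carrier (integer_mod_group d)" \<alpha> by fact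
  interpret G: group G using \<alpha>.group_hom by (simp add: group_hom_def)
  {
    case 0
    then show ?case using u \<alpha>.one_apply by simp
  next
    case (Suc j)
    then show ?case
      using u step[of u "int j"] x
      by (simp only: G.nat_pow_Suc2) (simp add: \<alpha>.composition_rule)
  }
qed

locale cyclic_cover =
  fixes n d m :: nat
  assumes n: "n > 1" and d: "d > 0" and m: "m = d * (n - 1) + 1"
begin

abbreviation "F \<equiv> free_group {..<n}"
abbreviation "E \<equiv> free_group {..<m}"
abbreviation "Z \<equiv> integer_mod_group d"

text \<open>
  The value \<open>1 mod int d\<close> instead of \<open>1\<close> makes \<open>shift\<close> land in the carrier also for \<open>d = 1\<close>.
\<close>

definition shift :: "nat \<Rightarrow> int" where
  "shift s = (if s = 0 then 1 mod int d else 0)"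

abbreviation "degree \<equiv> word_val Z shift"

definition K :: "(nat \<times> bool) list set" where
  "K = kernel F Z degree"

text \<open>
  Collapsing the maximal tree formed by the edges of generator \<open>0\<close> from \<open>z\<close> to \<open>z + 1\<close> leaves \<open>m\<close> edges,
  which name the generators of \<open>E\<close>: the closing edge of generator \<open>0\<close> gets index \<open>0\<close>, and the
  edge of generator \<open>s > 0\<close> at \<open>z\<close> gets index \<open>(s - 1) * d + z + 1\<close>.
\<close>

definition label :: "nat \<Rightarrow> int \<Rightarrow> (nat \<times> bool) list" where
  "label s z = (if s = 0 then (if z = int d - 1 then [(0, True)] else [])
    else [((s - 1) * d + nat z + 1, True)])"

text \<open>
  The loop that runs along the maximal tree to the edge with index \<open>k\<close>, through the edge, and back; the
  division recovers the generator and the vertex of that edge. The generators of \<open>F\<close> act from the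
  left, so a path is read from the right end of its word.
\<close>

definition cover_gen :: "nat \<Rightarrow> (nat \<times> bool) list" where
  "cover_gen k = (if k = 0 then [(0, True)] [^]\<^bsub>F\<^esub> d
    else inv\<^bsub>F\<^esub> ([(0, True)] [^]\<^bsub>F\<^esub> ((k - 1) mod d)) \<otimes>\<^bsub>F\<^esub> [((k - 1) div d + 1, True)]
      \<otimes>\<^bsub>F\<^esub> [(0, True)] [^]\<^bsub>F\<^esub> ((k - 1) mod d))"

definition \<psi> :: "(nat \<times> bool) list \<Rightarrow> (nat \<times> bool) list" where
  "\<psi> = word_val F cover_gen"

abbreviation "cover_action \<equiv> skew_action E Z shift label"

text \<open>
  The pair \<open>(u, z)\<close> stands for the element \<open>t\<^sup>z \<psi>(u)\<close> of the coset \<open>t\<^sup>z K\<close>, where \<open>t\<close> is generator \<open>0\<close>.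
\<close>

definition coset_point :: "(nat \<times> bool) list \<times> int \<Rightarrow> (nat \<times> bool) list" where
  "coset_point x = [(0, True)] [^]\<^bsub>F\<^esub> nat (snd x) \<otimes>\<^bsub>F\<^esub> \<psi> (fst x)"

sublocale F: group F by (rule group_free_group)
sublocale E: group E by (rule group_free_group)
sublocale Z: group Z by simp

lemma Z_carrier: "carrier Z = {0..<int d}"
  using d by (simp add: carrier_integer_mod_group)

lemma shift_closed: "shift \<in> {..<n} \<rightarrow> carrier Z"
  using d by (auto simp: shift_def Z_carrier)

sublocale degree: group_hom F Z degree
  by unfold_locales (rule Z.word_val_hom[OF shift_closed])

lemma label_index:
  assumes "s < n" "0 < s" "j < d"
  shows "(s - 1) * d + j + 1 < m"
proof -
  have "(s - 1) * d + j < (s - 1) * d + d" using assms by simp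
  also have "\<dots> = d * s" using assms by (cases s) auto
  also have "\<dots> \<le> d * (n - 1)" using assms by (intro mult_le_mono) auto
  finally show ?thesis by (simp add: m)
qed

lemma generators: "s < n \<Longrightarrow> [(s, True)] \<in> carrier F"
  by (simp add: generator_closed)

lemma label_closed: "label \<in> {..<n} \<rightarrow> carrier Z \<rightarrow> carrier E"
proof (intro Pi_I)
  fix s z assume "s \<in> {..<n}" "z \<in> carrier Z"
  then show "label s z \<in> carrier E"
    using label_index[of s "nat z"] m
    by (auto simp: label_def Z_carrier free_group_def reduced_Cons)
qed

lemma cover_gen_closed: "cover_gen \<in> {..<m} \<rightarrow> carrier F"
proof
  fix k assume k: "k \<in> {..<m}"
  have "(k - 1) div d + 1 < n" if "k \<noteq> 0"
  proof -
    have "(k - 1) div d < n - 1" using k that d by (simp add: m less_mult_imp_div_less mult.commute)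
    then show ?thesis by simp
  qed
  then show "cover_gen k \<in> carrier F"
    using generators[of 0] generators[of "(k - 1) div d + 1"] n by (auto simp: cover_gen_def)
qed

sublocale \<psi>: group_hom E F \<psi>
  by unfold_locales (simp add: \<psi>_def F.word_val_hom[OF cover_gen_closed])

sublocale \<alpha>: group_action F "carrier E \<times> carrier Z" cover_action
  by (rule skew_action_is_action[OF E.is_group Z.is_group shift_closed label_closed])

lemmas \<alpha>_generator = skew_action_generator[OF E.is_group Z.is_group shift_closed label_closed]
lemmas snd_\<alpha> = snd_skew_action[OF E.is_group Z.is_group shift_closed label_closed]

lemma \<psi>_generator: "k < m \<Longrightarrow> \<psi> [(k, True)] = cover_gen k"
  by (simp add: \<psi>_def F.word_val_generator[OF cover_gen_closed])

lemma \<psi>_label: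
  assumes s: "s < n" "0 < s" and j: "j < d"
  shows "\<psi> (label s (int j)) = inv\<^bsub>F\<^esub> ([(0, True)] [^]\<^bsub>F\<^esub> j) \<otimes>\<^bsub>F\<^esub> [(s, True)] \<otimes>\<^bsub>F\<^esub> [(0, True)] [^]\<^bsub>F\<^esub> j"
  using s j \<psi>_generator[OF label_index[OF assms]]
  by (simp add: label_def cover_gen_def)

text \<open>
  The labels are chosen so that \<open>s t\<^sup>z = t^z' \<psi>(label s z)\<close>, where \<open>z'\<close> is the vertex reached from \<open>z\<close>. Since the
  left regular action of \<open>F\<close> is transitive, equivariance makes \<open>coset_point\<close> surjective, which gives
  one inclusion in \<open>\<psi>_image\<close>.
\<close>

lemma coset_point_equivariant:
  assumes w: "w \<in> carrier F" and x: "x \<in> carrier E \<times> carrier Z"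
  shows "coset_point (cover_action w x) = w \<otimes>\<^bsub>F\<^esub> coset_point x"
proof -
  let ?L = "\<lambda>g. \<lambda>v\<in>carrier F. g \<otimes>\<^bsub>F\<^esub> v" and ?t = "[(0, True)]"
  have t: "?t \<in> carrier F" using n generators[of 0] by simp
  have C: "coset_point \<in> carrier E \<times> carrier Z \<rightarrow> carrier F"
    using t by (auto simp: coset_point_def)
  have id: "group_hom F F (\<lambda>w. w)" by unfold_locales (simp add: hom_def)
  have "coset_point (cover_action w x) = ?L w (coset_point x)"
  proof (rule equivariant_if_on_generators[OF \<alpha>.group_action_axioms left_regular_action[OF id] C _ w x])
    fix s x assume s: "s \<in> {..<n}" and x: "x \<in> carrier E \<times> carrier Z"
    obtain u z where uz: "x = (u, z)" "u \<in> carrier E" "z \<in> carrier Z" using x by auto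
    define j where "j = nat z"
    have j: "z = int j" "j < d" using uz(3) by (auto simp: j_def Z_carrier)
    have \<psi>u: "\<psi> u \<in> carrier F" using uz by simp
    have sF: "[(s, True)] \<in> carrier F" using s generators by simp
    have lab: "label s z \<in> carrier E" using funcset_mem[OF funcset_mem[OF label_closed s]] uz by blast
    have \<alpha>: "cover_action [(s, True)] (u, z) = (label s z \<otimes>\<^bsub>E\<^esub> u, (shift s + z) mod int d)"
      using \<alpha>_generator s uz by simp
    have "coset_point (cover_action [(s, True)] x) = [(s, True)] \<otimes>\<^bsub>F\<^esub> coset_point x"
    proof (cases "s = 0")
      case False
      then have "coset_point (cover_action [(s, True)] x) = ?t [^]\<^bsub>F\<^esub> j \<otimes>\<^bsub>F\<^esub> (\<psi> (label s (int j)) \<otimes>\<^bsub>F\<^esub> \<psi> u)"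
        using \<alpha> uz j lab by (simp add: coset_point_def shift_def \<psi>.hom_mult)
      also have "\<dots> = [(s, True)] \<otimes>\<^bsub>F\<^esub> (?t [^]\<^bsub>F\<^esub> j \<otimes>\<^bsub>F\<^esub> \<psi> u)"
        using False s j t sF \<psi>u by (simp add: \<psi>_label F.m_assoc F.inv_cancel_right)
      finally show ?thesis using uz j by (simp add: coset_point_def)
    next
      case s0: True
      have t_pow: "?t \<otimes>\<^bsub>F\<^esub> ?t [^]\<^bsub>F\<^esub> i = ?t [^]\<^bsub>F\<^esub> Suc i" for i using t F.nat_pow_Suc2 by simp
      have rhs: "[(s, True)] \<otimes>\<^bsub>F\<^esub> coset_point x = ?t [^]\<^bsub>F\<^esub> Suc j \<otimes>\<^bsub>F\<^esub> \<psi> u"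
        unfolding t_pow[symmetric] using s0 uz j t \<psi>u by (simp add: coset_point_def F.m_assoc)
      have shift: "(shift s + z) mod int d = int (Suc j mod d)"
        using s0 j by (simp add: shift_def mod_add_left_eq zmod_int)
      show ?thesis
      proof (cases "Suc j = d")
        case True
        then have "label s z = ?t" using s0 j by (auto simp: label_def)
        then have "coset_point (cover_action [(s, True)] x) = \<psi> ?t \<otimes>\<^bsub>F\<^esub> \<psi> u"
          unfolding uz(1) \<alpha> shift using True lab uz(2) \<psi>u by (simp add: coset_point_def)
        also have "\<psi> ?t = ?t [^]\<^bsub>F\<^esub> Suc j" using \<psi>_generator[of 0] m True by (simp add: cover_gen_def)
        finally show ?thesis by (simp only: rhs)
      next
        case False
        then have "label s z = \<one>\<^bsub>E\<^esub>" "Suc j < d" using s0 j by (auto simp: label_def free_group_def)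
        then show ?thesis
          unfolding uz(1) \<alpha> shift using rhs uz by (simp add: coset_point_def del: of_nat_Suc)
      qed
    qed
    then show "coset_point (cover_action [(s, True)] x) = ?L [(s, True)] (coset_point x)"
      using funcset_mem[OF C x] by simp
  qed
  then show ?thesis using funcset_mem[OF C x] by simp
qed

text \<open>
  Over the base vertex \<open>0\<close> the element \<open>v\<close> can be read off from the action of \<open>\<psi> v\<close>. Hence \<open>\<psi>\<close> is injective,
  and its image fixes the base vertex, so it lies in \<open>K\<close>.
\<close>

lemma cover_action_\<psi>:
  assumes v: "v \<in> carrier E" and u: "u \<in> carrier E"
  shows "cover_action (\<psi> v) (u, 0) = (v \<otimes>\<^bsub>E\<^esub> u, 0)"
proof -
  let ?L = "\<lambda>g. \<lambda>v\<in>carrier E. g \<otimes>\<^bsub>E\<^esub> v" and ?t = "[(0, True)]"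
  have id: "group_hom E E (\<lambda>w. w)" by unfold_locales (simp add: hom_def)
  have t: "?t \<in> carrier F" using n generators[of 0] by simp
  have zero: "0 \<in> carrier Z" using d by (simp add: Z_carrier)
  have act: "group_action E (carrier E \<times> carrier Z) (cover_action \<circ> \<psi>)"
    using \<alpha>.group_hom hom_compose[OF \<psi>.homh, of cover_action]
    by (auto simp: group_action_def group_hom_def group_hom_axioms_def E.is_group)
  have "u \<in> carrier E \<Longrightarrow> 0 \<le> z \<Longrightarrow> z + 1 < int d \<Longrightarrow> cover_action ?t (u, z) = (u, z + 1)" for u z
    using n \<alpha>_generator[of 0 u z] E.l_one[of u]
    by (simp add: Z_carrier label_def shift_def free_group_def add.commute mod_add_left_eq)
  note pow = nat_pow_generator_skew_action[OF \<alpha>.group_action_axioms t this]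
  have gen: "cover_action (\<psi> [(k, True)]) (u, 0) = ([(k, True)] \<otimes>\<^bsub>E\<^esub> u, 0)"
    if k: "k < m" and u: "u \<in> carrier E" for k u
  proof (cases "k = 0")
    case True
    obtain d' where d': "d = Suc d'" using d by (cases d) auto
    have "?t [^]\<^bsub>F\<^esub> d = ?t \<otimes>\<^bsub>F\<^esub> ?t [^]\<^bsub>F\<^esub> d'" unfolding d' using t by (rule F.nat_pow_Suc2)
    moreover have "d' < d" using d' by simp
    ultimately have "cover_action (\<psi> [(k, True)]) (u, 0) = cover_action ?t (u, int d')"
      using True \<psi>_generator[OF k] t u zero pow[OF _ _ _ u, of d']
      by (simp add: cover_gen_def \<alpha>.composition_rule del: F.nat_pow_Suc)
    also have "\<dots> = (?t \<otimes>\<^bsub>E\<^esub> u, 0)"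
    proof -
      have "int d' = int d - 1" "int d' \<in> carrier Z" using d' unfolding Z_carrier by auto
      then show ?thesis
        using n u \<alpha>_generator[of 0 u "int d'"] by (simp add: label_def shift_def mod_add_left_eq)
    qed
    finally show ?thesis using True by simp
  next
    case False
    define j where "j = (k - 1) mod d"
    define s where "s = (k - 1) div d + 1"
    have j: "j < d" using d by (simp add: j_def)
    have "(k - 1) div d < n - 1" using k False d by (simp add: m less_mult_imp_div_less mult.commute)
    then have s: "s < n" "0 < s" by (auto simp: s_def)
    have kk: "label s (int j) = [(k, True)]"
      using False by (simp add: label_def s_def j_def)
    have k_closed: "[(k, True)] \<in> carrier E" using k by (simp add: generator_closed)
    let ?p = "?t [^]\<^bsub>F\<^esub> j"
    have p: "?p \<in> carrier F" "[(s, True)] \<in> carrier F" using t s generators by simp_all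
    have jZ: "int j \<in> carrier Z" using j by (simp add: Z_carrier)
    have s_act: "cover_action [(s, True)] (u, int j) = ([(k, True)] \<otimes>\<^bsub>E\<^esub> u, int j)"
      using \<alpha>_generator[of s u "int j"] s u j jZ kk by (simp add: shift_def)
    have \<psi>k: "\<psi> [(k, True)] = inv\<^bsub>F\<^esub> ?p \<otimes>\<^bsub>F\<^esub> [(s, True)] \<otimes>\<^bsub>F\<^esub> ?p"
      using False \<psi>_generator[OF k] by (simp add: cover_gen_def s_def j_def)
    have "cover_action (\<psi> [(k, True)]) (u, 0) = cover_action (inv\<^bsub>F\<^esub> ?p) (cover_action [(s, True)] (cover_action ?p (u, 0)))"
      using \<psi>k p u zero \<alpha>.element_image[OF p(1) _ refl] \<alpha>.element_image[OF p(2) _ refl]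
      by (simp add: \<alpha>.composition_rule)
    also have "\<dots> = cover_action (inv\<^bsub>F\<^esub> ?p) ([(k, True)] \<otimes>\<^bsub>E\<^esub> u, int j)"
      using pow[OF _ _ _ u j] s_act by simp
    also have "\<dots> = ([(k, True)] \<otimes>\<^bsub>E\<^esub> u, 0)"
      using \<alpha>.orbit_sym_aux[OF p(1) _ pow[OF _ _ _ _ j]] u k_closed zero by simp
    finally show ?thesis .
  qed
  have "(?L v u, 0) = (cover_action \<circ> \<psi>) v (u, 0)"
  proof (rule equivariant_if_on_generators[OF left_regular_action[OF id] act _ _ v u])
    show "(?L [(k, True)] x, 0) = (cover_action \<circ> \<psi>) [(k, True)] (x, 0)"
      if "k \<in> {..<m}" "x \<in> carrier E" for k x
      using gen that by simp
  qed (use zero in auto)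
  then show ?thesis using u by simp
qed

lemma \<psi>_mon: "\<psi> \<in> mon E F"
proof -
  have "inj_on \<psi> (carrier E)"
    using cover_action_\<psi>[OF _ E.one_closed] by (intro inj_onI) (metis E.r_one fst_conv)
  then show ?thesis using \<psi>.homh by (simp add: mon_def)
qed

lemma \<psi>_image: "\<psi> ` carrier E = K"
proof
  have zero: "0 \<in> carrier Z" using d by (simp add: Z_carrier)
  have degree_snd: "degree w = snd (cover_action w (\<one>\<^bsub>E\<^esub>, 0))" if "w \<in> carrier F" for w
    using snd_\<alpha>[OF that E.one_closed zero] degree.hom_closed[OF that] d by (simp add: Z_carrier)
  show "\<psi> ` carrier E \<subseteq> K"
    using cover_action_\<psi>[OF _ E.one_closed] by (auto simp: K_def kernel_def degree_snd)
  show "K \<subseteq> \<psi> ` carrier E"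
  proof
    fix w assume "w \<in> K"
    then have w: "w \<in> carrier F" "degree w = 0" by (auto simp: K_def kernel_def)
    have x: "(\<one>\<^bsub>E\<^esub>, 0) \<in> carrier E \<times> carrier Z" using zero by simp
    obtain u where u: "cover_action w (\<one>\<^bsub>E\<^esub>, 0) = (u, 0)"
      using degree_snd[OF w(1)] w(2) by (metis prod.collapse)
    then have "u \<in> carrier E" using \<alpha>.element_image[OF w(1) x u] by simp
    moreover have "w = \<psi> u"
      using coset_point_equivariant[OF w(1) x] u w(1) \<open>u \<in> carrier E\<close>
      by (simp add: coset_point_def)
    ultimately show "w \<in> \<psi> ` carrier E" by blast
  qed
qed

section \<open>A subgroup of finite index whose inner automorphisms come from K\<close>

lemma K_normal: "K \<lhd> F"
  unfolding K_def by (rule degree.normal_kernel)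

text \<open>
  \<open>K\<close> contains generator \<open>1\<close> and, being normal, also its conjugate by generator \<open>0\<close>; only the identity commutes with both.
\<close>

lemma K_trivial_centralizer:
  assumes w: "w \<in> carrier F" and comm: "\<And>k. k \<in> K \<Longrightarrow> w \<otimes>\<^bsub>F\<^esub> k = k \<otimes>\<^bsub>F\<^esub> w"
  shows "w = \<one>\<^bsub>F\<^esub>"
proof -
  have gens: "[(0, True)] \<in> carrier F" "[(1, True)] \<in> carrier F" using n generators by simp_all
  have "[(1, True)] \<in> K"
    using n Z.word_val_generator[OF shift_closed, of 1] gens by (simp add: K_def kernel_def shift_def)
  moreover from normal.inv_op_closed2[OF K_normal gens(1) this]
  have "[(0, True)] \<otimes>\<^bsub>F\<^esub> [(1, True)] \<otimes>\<^bsub>F\<^esub> inv\<^bsub>F\<^esub> [(0, True)] \<in> K" .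
  ultimately show ?thesis
    using n comm w by (intro trivial_centralizer_of_generator_and_conjugate[of 1 "{..<n}" 0]) auto
qed

text \<open>
  Labels modulo 2 that are nonzero on a single edge, the loop of generator \<open>1\<close> at the vertex \<open>0\<close>. The
  resulting permutation representation has finite range and distinguishes the vertex \<open>0\<close>.
\<close>

definition mark :: "nat \<Rightarrow> int \<Rightarrow> int" where
  "mark s z = (if s = 1 \<and> z = 0 then 1 else 0)"

abbreviation "Z2 \<equiv> integer_mod_group 2"
abbreviation "finite_action \<equiv> skew_action Z2 Z shift mark"

lemma mark_closed: "mark \<in> {..<n} \<rightarrow> carrier Z \<rightarrow> carrier Z2"
  by (auto simp: mark_def carrier_integer_mod_group)

sublocale h: group_action F "carrier Z2 \<times> carrier Z" finite_action
  by (rule skew_action_is_action[OF _ Z.is_group shift_closed mark_closed]) simp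

lemma finite_action_range: "finite (carrier (BijGroup (carrier Z2 \<times> carrier Z)))"
proof -
  let ?X = "carrier Z2 \<times> carrier Z"
  have "carrier (BijGroup ?X) \<subseteq> ?X \<rightarrow>\<^sub>E ?X"
    by (auto simp: BijGroup_def Bij_def bij_betw_def PiE_def)
  moreover have "finite ?X"
    unfolding Z_carrier by (simp add: carrier_integer_mod_group)
  ultimately show ?thesis using finite_PiE finite_subset by metis
qed

lemma degree_eq_snd_finite_action: "w \<in> carrier F \<Longrightarrow> degree w = snd (finite_action w (0, 0))"
  using snd_skew_action[OF _ Z.is_group shift_closed mark_closed, of w 0 0] degree.hom_closed[of w] d
  by (simp add: Z_carrier carrier_integer_mod_group)

lemma stabilizer_preserves_K: "\<phi> \<in> hom_stabilizer F finite_action \<Longrightarrow> w \<in> K \<Longrightarrow> \<phi> w \<in> K"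
  by (auto simp: hom_stabilizer_def K_def kernel_def degree_eq_snd_finite_action auto_closed)

text \<open>
  The permutation of \<open>g\<close> commutes with that of generator \<open>1\<close>, which moves exactly the two points over
  \<open>0\<close>. So \<open>g\<close> maps this fibre to itself, which means that its degree is \<open>0\<close>.
\<close>

lemma inner_stabilizer_in_K:
  assumes g: "g \<in> carrier F" and inner: "inner_aut F g \<in> hom_stabilizer F finite_action"
  shows "g \<in> K"
proof -
  let ?X = "carrier Z2 \<times> carrier Z" and ?b = "[(1, True)]"
  have b: "?b \<in> carrier F" using n generators by simp
  have bX: "finite_action ?b (u, z) = ((mark 1 z + u) mod 2, z)" if "(u, z) \<in> ?X" for u z
    using skew_action_generator[OF _ Z.is_group shift_closed mark_closed, of 1 u z] that n
    by (simp add: shift_def Z_carrier)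
  have X: "(0, 0) \<in> ?X" "(1, 0) \<in> ?X" using d by (auto simp: Z_carrier carrier_integer_mod_group)
  have "finite_action g \<otimes>\<^bsub>BijGroup ?X\<^esub> finite_action ?b = finite_action ?b \<otimes>\<^bsub>BijGroup ?X\<^esub> finite_action g"
    by (rule inner_aut_in_hom_stabilizer[OF h.group_hom g inner b])
  then have "finite_action (g \<otimes>\<^bsub>F\<^esub> ?b) (0, 0) = finite_action (?b \<otimes>\<^bsub>F\<^esub> g) (0, 0)"
    using h.group_hom g b by (simp add: group_hom.hom_mult)
  then have "finite_action g (1, 0) = finite_action ?b (finite_action g (0, 0))"
    using h.composition_rule[OF X(1)] g b bX X by (simp add: mark_def)
  moreover have "finite_action g (1, 0) \<noteq> finite_action g (0, 0)"
    using inj_onD[OF h.inj_prop[OF g] _ X(2,1)] by auto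
  ultimately have "finite_action ?b (finite_action g (0, 0)) \<noteq> finite_action g (0, 0)"
    by simp
  moreover have "finite_action g (0, 0) \<in> ?X" using h.element_image[OF g X(1) refl] .
  ultimately have "snd (finite_action g (0, 0)) = 0"
    using bX by (cases "finite_action g (0, 0)") (auto simp: mark_def carrier_integer_mod_group split: if_splits)
  then show ?thesis using g degree_eq_snd_finite_action by (simp add: K_def kernel_def)
qed

theorem finite_index_mon_Out:
  "\<exists>\<Gamma> \<Phi>. finite_index_subgroup \<Gamma> (Out F) \<and> \<Phi> \<in> mon (Out F \<lparr>carrier := \<Gamma>\<rparr>) (Out E)"
proof -
  let ?S = "hom_stabilizer F finite_action"
  let ?\<Gamma> = "(\<lambda>\<phi>. Inn F #>\<^bsub>AutoGroup F\<^esub> \<phi>) ` ?S"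
  have hom: "finite_action \<in> hom F (BijGroup (carrier Z2 \<times> carrier Z))"
    using h.group_hom by (simp add: group_hom_def group_hom_axioms_def)
  have "finite_index_subgroup ?S (AutoGroup F)"
    by (rule finite_index_hom_stabilizer[OF _ group_BijGroup finite_action_range hom]) simp
  then have "finite_index_subgroup ?\<Gamma> (Out F)"
    by (rule group_hom.finite_index_subgroup_image[OF F.Out_proj])
  moreover have "\<exists>\<Phi>. \<Phi> \<in> mon (Out F \<lparr>carrier := ?\<Gamma>\<rparr>) (Out E)"
  proof (rule restricted_outer_mon[OF F.is_group E.is_group \<psi>_mon _ _ F.hom_stabilizer_subgroup])
    show "\<psi> ` carrier E \<lhd> F" unfolding \<psi>_image by (rule K_normal)
    show "x = \<one>\<^bsub>F\<^esub>"
      if "x \<in> carrier F" "\<forall>u\<in>carrier E. x \<otimes>\<^bsub>F\<^esub> \<psi> u = \<psi> u \<otimes>\<^bsub>F\<^esub> x" for x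
      using that by (intro K_trivial_centralizer) (auto simp flip: \<psi>_image)
  qed (simp_all only: \<psi>_image stabilizer_preserves_K inner_stabilizer_in_K)
  ultimately show ?thesis by blast
qed

end

theorem proposition2p5:
  fixes n d m :: nat
  assumes "n > 0" and "d > 0" and "m = d * (n - 1) + 1"
  shows "\<exists>\<Gamma> \<phi>. finite_index_subgroup \<Gamma> (Out (free_group_rank n)) \<and>
    \<phi> \<in> mon (Out (free_group_rank n) \<lparr>carrier := \<Gamma>\<rparr>) (Out (free_group_rank m))"
proof (cases "n = 1")
  case True
  let ?O = "Out (free_group_rank n)"
  have "m = n" using True assms by simp
  moreover have "finite_index_subgroup (carrier ?O) ?O"
    unfolding free_group_rank_def
    by (intro group.finite_index_subgroup_carrier group.group_Out group_free_group)
  moreover have "(\<lambda>x. x) \<in> mon (?O \<lparr>carrier := carrier ?O\<rparr>) ?O"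
    by (simp add: mon_def hom_def)
  ultimately show ?thesis by blast
next
  case False
  then interpret cyclic_cover n d m using assms by unfold_locales auto
  show ?thesis using finite_index_mon_Out unfolding free_group_rank_def .
qed

end
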